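(* Let $m,n\ge1$ be integers. The Hilbert series $P(t)=\sum_{k\ge0}b_kt^k$ of the algebra of quasi-invariants $Q_{\mathcal{A}_{(m,1^n)}}$, where $b_k$ is the dimension of its homogeneous component of degree $k$, is given by $$P(t)=\frac{1-t^2+t^{n+1}+t^{n+2}+t^{2m+n}+t^{2m+n+1}-t^{2m+2n}+t^{2m+2n+2}}{(t^2-1)^2}.$$
   Context: The configuration $\mathcal{A}_{(m,1^n)}$ consists of the pairwise non-collinear real vectors $\alpha_s=(\cos\varphi_s,\sin\varphi_s)$, $0\le s\le n$, with $\alpha_0=(1,0)$ and multiplicities $m_0=m$, $m_i=1$ for $1\le i\le n$, such that, with $z_s=e^{2i\varphi_s}$, the elementary symmetric polynomials $e_k=e_k(z_1,\dots,z_n)$ have the values $e_k=(-1)^k\binom{n}{k}\binom{m+k-1}{k}\binom{m+n-1}{k}^{-1}$ for $1\le k\le n$. For a configuration $\mathcal{A}$ of vectors $\alpha_i\in\mathbb{C}^2$ with multiplicities $m_i$, the graded algebra $Q_{\mathcal{A}}\subset\mathbb{C}[x_1,x_2]$ of quasi-invariants consists of the polynomials $p$ such that $\partial_{\alpha_i}^{2s-1}p|_{\Pi_i}=0$ for all $i$ and all $1\le s\le m_i$, where $(u,v)=u_1v_1+u_2v_2$, $\partial_{\alpha_i}=(\alpha_i,\frac{\partial}{\partial x})$ and $\Pi_i=\{x:(\alpha_i,x)=0\}$. *)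

theory Defs
  imports "HOL-Analysis.Analysis" "HOL-Computational_Algebra.Computational_Algebra"
begin

text \<open>
  The ring \<open>\<complex>[x\<^sub>1, x\<^sub>2]\<close> is rendered as \<open>\<complex>[x\<^sub>1][x\<^sub>2]\<close>, i.e. as the type
  \<^typ>\<open>complex poly poly\<close>: the outer variable is \<open>x\<^sub>2\<close>, and the coefficient of
  \<open>x\<^sub>1\<^sup>i x\<^sub>2\<^sup>j\<close> in \<open>p\<close> is \<open>coeff (coeff p j) i\<close>.
\<close>

type_synonym cpoly2 = "complex poly poly"

definition eval2 :: "cpoly2 \<Rightarrow> complex \<times> complex \<Rightarrow> complex" where
  "eval2 p x = poly (poly p [:snd x:]) (fst x)"

definition scale2 :: "complex \<Rightarrow> cpoly2 \<Rightarrow> cpoly2" where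
  "scale2 c p = smult [:c:] p"

interpretation cpoly2: vector_space scale2
  by unfold_locales (simp_all add: scale2_def smult_add_right mult.commute
      flip: smult_add_left one_pCons)

definition dir_deriv :: "complex \<times> complex \<Rightarrow> cpoly2 \<Rightarrow> cpoly2" where
  "dir_deriv a p = scale2 (fst a) (map_poly pderiv p) + scale2 (snd a) (pderiv p)"

text \<open>The bilinear (not Hermitian) form on \<open>\<complex>\<^sup>2\<close>.\<close>

definition bil :: "complex \<times> complex \<Rightarrow> complex \<times> complex \<Rightarrow> complex" where
  "bil u v = fst u * fst v + snd u * snd v"

definition quasi_invariants ::
    "'i set \<Rightarrow> ('i \<Rightarrow> complex \<times> complex) \<Rightarrow> ('i \<Rightarrow> nat) \<Rightarrow> cpoly2 set" where
  "quasi_invariants I \<alpha> \<mu> =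
     {p. \<forall>i\<in>I. \<forall>s\<in>{1..\<mu> i}. \<forall>x. bil (\<alpha> i) x = 0 \<longrightarrow>
           eval2 ((dir_deriv (\<alpha> i) ^^ (2 * s - 1)) p) x = 0}"

definition homogeneous2 :: "nat \<Rightarrow> cpoly2 set" where
  "homogeneous2 k = {p. \<forall>i j. coeff (coeff p j) i \<noteq> 0 \<longrightarrow> i + j = k}"

text \<open>The coefficients are natural numbers; they are taken in \<open>\<rat>\<close> so that
  power series can be divided.\<close>

definition hilbert_series :: "cpoly2 set \<Rightarrow> rat fps" where
  "hilbert_series Q = Abs_fps (\<lambda>k. of_nat (cpoly2.dim (Q \<inter> homogeneous2 k)))"

definition esym :: "'i set \<Rightarrow> nat \<Rightarrow> ('i \<Rightarrow> 'a :: comm_semiring_1) \<Rightarrow> 'a" where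
  "esym I k z = (\<Sum>X | X \<subseteq> I \<and> card X = k. \<Prod>i\<in>X. z i)"

definition unit_vec :: "real \<Rightarrow> real \<times> real" where
  "unit_vec t = (cos t, sin t)"

definition complexify :: "real \<times> real \<Rightarrow> complex \<times> complex" where
  "complexify u = (complex_of_real (fst u), complex_of_real (snd u))"

text \<open>The defining property of the angles \<open>\<phi>\<^sub>0, \<dots>, \<phi>\<^sub>n\<close> of the configuration
  \<open>\<A>\<^bsub>(m,1\<^sup>n)\<^esub>\<close>; two vectors are collinear if they lie on a common line
  through the origin.\<close>

definition config_angles :: "nat \<Rightarrow> nat \<Rightarrow> (nat \<Rightarrow> real) \<Rightarrow> bool" where
  "config_angles m n \<phi> \<longleftrightarrow>
     unit_vec (\<phi> 0) = (1, 0) \<and>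
     (\<forall>s\<le>n. \<forall>r\<le>n. s \<noteq> r \<longrightarrow> \<not> collinear {0, unit_vec (\<phi> s), unit_vec (\<phi> r)}) \<and>
     (\<forall>k\<in>{1..n}. esym {1..n} k (\<lambda>s. exp (2 * \<i> * complex_of_real (\<phi> s))) =
        (-1) ^ k * of_nat (n choose k) * of_nat ((m + k - 1) choose k)
          * inverse (of_nat ((m + n - 1) choose k)))"

definition config_mult :: "nat \<Rightarrow> nat \<Rightarrow> nat" where
  "config_mult m s = (if s = 0 then m else 1)"

definition Q_config :: "nat \<Rightarrow> nat \<Rightarrow> (nat \<Rightarrow> real) \<Rightarrow> cpoly2 set" where
  "Q_config m n \<phi> =
     quasi_invariants {0..n} (\<lambda>s. complexify (unit_vec (\<phi> s))) (config_mult m)"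

end

theory Submission
  imports Defs "HOL-Computational_Algebra.Field_as_Ring"
begin

text \<open>
  The point \<open>(- sin \<theta>, cos \<theta>)\<close> spans the line orthogonal to \<open>(cos \<theta>, sin \<theta>)\<close>, and on these points a
  form of degree \<open>k\<close> satisfying the conditions for \<open>\<alpha>\<^sub>0\<close> reads \<open>a(cos \<theta>) - sin\<^bsup>2m+1\<^esup> \<theta> b(cos \<theta>)\<close>, where \<open>a\<close>
  has the parity of \<open>k\<close> and degree at most \<open>k\<close>, and \<open>b\<close> has the opposite parity and degree at most
  \<open>k - 2m - 1\<close>. The elementary symmetric polynomials of the \<open>z\<^sub>i\<close> say that, for the Gegenbauer polynomial
  \<open>C\<close> of degree \<open>n\<close> and parameter \<open>m\<close>, \<open>C(cos \<theta>)\<close> is a multiple of \<open>e\<^bsup>-in\<theta>\<^esup> \<Prod>\<^sub>i (e\<^bsup>2i\<theta>\<^esup> - z\<^sub>i)\<close>.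
  The set of the \<open>z\<^sub>i\<close> is thus closed under inversion, so the remaining conditions separate: \<open>C\<close> divides
  \<open>a'\<close>, and \<open>C\<close> divides \<open>(2m+1) x b - (1 - x\<^sup>2) b'\<close>. By the differential equation of \<open>C\<close> the latter
  means that \<open>b / C\<^sup>2\<close> has no residues, i.e. that \<open>b\<close> is a Wronskian \<open>C' q - C q'\<close>. Hence the possible
  degrees of \<open>a\<close> are \<open>0\<close> and all \<open>d \<ge> n + 1\<close>, those of \<open>b\<close> are all \<open>d \<ge> n - 1\<close> other than \<open>2n - 1\<close>
  (each within the bounds above), and counting degrees gives the dimensions.
\<close>

section \<open>Dimension as the number of degrees\<close>

interpretation poly_vs: vector_space "smult :: 'a::field \<Rightarrow> 'a poly \<Rightarrow> 'a poly"
  by unfold_locales (simp_all add: smult_add_right smult_add_left)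

interpretation poly_cpoly2: vector_space_pair "smult :: complex \<Rightarrow> complex poly \<Rightarrow> complex poly" scale2
  by unfold_locales

lemma subspace_degree_less: "poly_vs.subspace {p. p = 0 \<or> degree p < d}"
  by (auto simp: poly_vs.subspace_def intro: degree_add_less)

text \<open>The elements are adjoined in increasing order of degree; the span of the earlier ones
  contains only 0 and polynomials of smaller degree.\<close>

lemma independent_distinct_degrees:
  fixes y :: "nat \<Rightarrow> 'a::field poly"
  assumes "finite D" "\<And>d. d \<in> D \<Longrightarrow> y d \<noteq> 0 \<and> degree (y d) = d"
  shows "poly_vs.independent (y ` D)"
  using assms
proof (induction D rule: finite_linorder_max_induct)
  case empty
  then show ?case by (simp add: poly_vs.independent_empty)
next
  case (insert d D)
  have "poly_vs.span (y ` D) \<subseteq> {p. p = 0 \<or> degree p < d}"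
    using insert.hyps insert.prems by (intro poly_vs.span_minimal subspace_degree_less) auto
  moreover have "y d \<noteq> 0" "degree (y d) = d" using insert.prems by auto
  ultimately have "y d \<notin> poly_vs.span (y ` D)" by auto
  moreover have "poly_vs.independent (y ` D)" using insert by auto
  ultimately show ?case using poly_vs.independent_insertI by simp
qed

text \<open>Elimination of leading terms: subtracting a multiple of the element of \<open>S\<close>
  of the same degree lowers the degree and stays within \<open>Y\<close>.\<close>

lemma subspace_subset_span_degrees:
  fixes Y :: "'a::field poly set"
  assumes Y: "poly_vs.subspace Y" and S: "S \<subseteq> Y"
    and deg: "\<And>p. p \<in> Y \<Longrightarrow> p \<noteq> 0 \<Longrightarrow> \<exists>q\<in>S. q \<noteq> 0 \<and> degree q = degree p"
  shows "Y \<subseteq> poly_vs.span S"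
proof
  fix p assume "p \<in> Y"
  then show "p \<in> poly_vs.span S"
  proof (induction "degree p" arbitrary: p rule: less_induct)
    case less
    show ?case
    proof (cases "p = 0")
      case False
      with less.prems deg obtain q where q: "q \<in> S" "q \<noteq> 0" "degree q = degree p" by blast
      define c where "c = lead_coeff p / lead_coeff q"
      define r where "r = p - smult c q"
      have rY: "r \<in> Y" unfolding r_def
        using less.prems q S Y by (meson poly_vs.subspace_diff poly_vs.subspace_scale subsetD)
      have "r \<in> poly_vs.span S"
      proof (cases "r = 0")
        case False
        have "coeff q (degree p) \<noteq> 0" using q by (metis leading_coeff_0_iff)
        then have "coeff r (degree p) = 0" by (simp add: r_def c_def q(3))
        moreover have "degree r \<le> degree p" 
          unfolding r_def using q by (intro degree_diff_le) auto
        ultimately have "degree r < degree p"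
          using False by (metis eq_zero_or_degree_less)
        with less.hyps rY show ?thesis by blast
      qed (simp add: poly_vs.span_zero)
      then have "r + smult c q \<in> poly_vs.span S"
        by (rule poly_vs.span_add[OF _ poly_vs.span_scale[OF poly_vs.span_base[OF q(1)]]])
      then show ?thesis by (simp add: r_def)
    qed (simp add: poly_vs.span_zero)
  qed
qed

text \<open>One polynomial for each occurring degree gives a basis of \<open>Y\<close>, and a linear
  map injective on \<open>Y\<close> carries it to a basis of the image. This turns the dimensions
  into counts of degrees.\<close>

lemma dim_image_eq_card_degrees:
  assumes lin: "Vector_Spaces.linear smult scale2 \<Psi>" and inj: "inj_on \<Psi> Y"
    and Y: "poly_vs.subspace Y" and fin: "finite (degree ` (Y - {0}))"
  shows "cpoly2.dim (\<Psi> ` Y) = card (degree ` (Y - {0}))"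
proof -
  define D where "D = degree ` (Y - {0})"
  have "\<forall>d\<in>D. \<exists>p\<in>Y. p \<noteq> 0 \<and> degree p = d" by (auto simp: D_def)
  then obtain y where y: "\<And>d. d \<in> D \<Longrightarrow> y d \<in> Y \<and> y d \<noteq> 0 \<and> degree (y d) = d" by metis
  have "poly_vs.independent (y ` D)"
    using y fin by (intro independent_distinct_degrees) (auto simp: D_def)
  moreover have "Y \<subseteq> poly_vs.span (y ` D)"
    using y by (intro subspace_subset_span_degrees[OF Y]) (auto simp: D_def)
  then have span: "poly_vs.span (y ` D) = Y"
    using y Y by (intro poly_vs.span_subspace) auto
  ultimately have ind: "cpoly2.independent (\<Psi> ` y ` D)"
    using poly_cpoly2.linear_independent_injective_image[OF lin] inj by simp
  have "cpoly2.span (\<Psi> ` y ` D) = \<Psi> ` Y"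
    using poly_cpoly2.linear_span_image[OF lin] span by simp
  then have "cpoly2.dim (\<Psi> ` Y) = card (\<Psi> ` y ` D)"
    using cpoly2.dim_span_eq_card_independent[OF ind] by simp
  also have "\<dots> = card (y ` D)" using y by (intro card_image inj_on_subset[OF inj]) auto
  also have "\<dots> = card D" using y by (intro card_image inj_on_inverseI[of _ degree]) auto
  finally show ?thesis by (simp add: D_def)
qed

section \<open>Parity, primitives and Wronskians\<close>

text \<open>Parity is recorded by a number rather than a truth value, so that it adds under products
  and moves by one under derivatives and primitives. The zero polynomial has both parities.\<close>

definition has_parity :: "nat \<Rightarrow> 'a::zero poly \<Rightarrow> bool" where
  "has_parity N p \<longleftrightarrow> (\<forall>j. coeff p j \<noteq> 0 \<longrightarrow> even (N + j))"

lemma has_parity_0 [simp]: "has_parity N 0"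
  by (simp add: has_parity_def)

lemma has_parity_cong: "even (M + N) \<Longrightarrow> has_parity M p \<longleftrightarrow> has_parity N p"
  unfolding has_parity_def by (metis even_add)

lemma has_parity_add: "has_parity N p \<Longrightarrow> has_parity N q \<Longrightarrow> has_parity N (p + q)"
  unfolding has_parity_def
proof (intro allI impI)
  fix j
  assume *: "\<forall>j. coeff p j \<noteq> 0 \<longrightarrow> even (N + j)" "\<forall>j. coeff q j \<noteq> 0 \<longrightarrow> even (N + j)"
    and "coeff (p + q) j \<noteq> 0"
  then have "coeff p j \<noteq> 0 \<or> coeff q j \<noteq> 0" by (auto simp del: even_add)
  with * show "even (N + j)" by blast
qed

lemma has_parity_uminus: "has_parity N (p :: 'a::ab_group_add poly) \<Longrightarrow> has_parity N (- p)"
  by (simp add: has_parity_def)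

lemma has_parity_diff:
  "has_parity N (p :: 'a::ab_group_add poly) \<Longrightarrow> has_parity N q \<Longrightarrow> has_parity N (p - q)"
  using has_parity_add[of N p "- q"] has_parity_uminus[of N q] by simp

lemma has_parity_smult: "has_parity N p \<Longrightarrow> has_parity N (smult c p)" for c :: "'a::idom"
  unfolding has_parity_def coeff_smult mult_eq_0_iff by blast

lemma has_parity_sum: "(\<And>i. i \<in> A \<Longrightarrow> has_parity N (p i)) \<Longrightarrow> has_parity N (sum p A)"
  by (induction A rule: infinite_finite_induct) (auto intro: has_parity_add)

lemma has_parity_monom: "even (N + j) \<Longrightarrow> has_parity N (monom c j)"
  by (auto simp: has_parity_def)

lemma has_parity_mult:
  assumes "has_parity M p" "has_parity N q"
  shows "has_parity (M + N) (p * q)"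
  unfolding has_parity_def
proof (intro allI impI)
  fix j assume "coeff (p * q) j \<noteq> 0"
  then obtain i where "i \<le> j" "coeff p i * coeff q (j - i) \<noteq> 0"
    unfolding coeff_mult by (meson atMost_iff sum.neutral)
  then have "even (M + i)" "even (N + (j - i))"
    using assms unfolding has_parity_def by (metis mult_zero_left mult_zero_right)+
  moreover have "M + N + j = (M + i) + (N + (j - i))" using \<open>i \<le> j\<close> by simp
  ultimately show "even (M + N + j)" by (metis even_add)
qed

lemma has_parity_power: "has_parity M p \<Longrightarrow> has_parity (M * k) (p ^ k :: 'a::comm_semiring_1 poly)"
proof (induction k)
  case (Suc k)
  then show ?case using has_parity_mult[of M p "M * k" "p ^ k"] by simp
qed (simp add: has_parity_def coeff_1)

lemma has_parity_pderiv:
  assumes "has_parity N p"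
  shows "has_parity (Suc N) (pderiv p)"
  unfolding has_parity_def
proof (intro allI impI)
  fix j assume "coeff (pderiv p) j \<noteq> 0"
  then have "coeff p (Suc j) \<noteq> 0" by (auto simp: coeff_pderiv)
  then have "even (N + Suc j)" using assms unfolding has_parity_def by blast
  then show "even (Suc N + j)" by simp
qed

text \<open>The primitive with constant term 0; this choice makes the parity flip without
  exception.\<close>

definition poly_integral :: "'a::field_char_0 poly \<Rightarrow> 'a poly" where
  "poly_integral p = (\<Sum>i\<le>degree p. monom (coeff p i / of_nat (Suc i)) (Suc i))"

lemma coeff_poly_integral:
  "coeff (poly_integral p) j = (if j = 0 then 0 else coeff p (j - 1) / of_nat j)"
proof (cases j)
  case (Suc k)
  show ?thesis
  proof (cases "k \<le> degree p")
    case True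
    then show ?thesis by (simp add: poly_integral_def coeff_sum Suc if_distrib sum.If_cases cong: if_cong)
  next
    case False
    then have "coeff p k = 0" by (simp add: coeff_eq_0)
    with False show ?thesis
      by (auto simp: poly_integral_def coeff_sum Suc intro!: sum.neutral)
  qed
qed (simp add: poly_integral_def coeff_sum)

lemma pderiv_poly_integral [simp]: "pderiv (poly_integral p) = p"
  by (intro poly_eqI) (simp add: coeff_pderiv coeff_poly_integral del: of_nat_Suc)

lemma degree_poly_integral: "p \<noteq> 0 \<Longrightarrow> degree (poly_integral p) = Suc (degree p)"
proof (intro antisym degree_le allI impI le_degree)
  fix i assume "Suc (degree p) < i"
  then show "coeff (poly_integral p) i = 0" by (simp add: coeff_poly_integral coeff_eq_0)
qed (simp add: coeff_poly_integral del: of_nat_Suc)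

lemma has_parity_poly_integral: "has_parity N p \<Longrightarrow> has_parity (Suc N) (poly_integral p)"
  unfolding has_parity_def
proof (intro allI impI)
  fix j assume p: "\<forall>j. coeff p j \<noteq> 0 \<longrightarrow> even (N + j)" and "coeff (poly_integral p) j \<noteq> 0"
  then have "j \<noteq> 0" "coeff p (j - 1) \<noteq> 0" by (auto simp: coeff_poly_integral split: if_splits)
  moreover from p this have "even (N + (j - 1))" by blast
  ultimately show "even (Suc N + j)" by (cases j) auto
qed

section \<open>Squarefree complex polynomials and Wronskians\<close>

lemma prod_linear_dvd:
  fixes q :: "'a::idom poly"
  assumes "finite R" "\<forall>x\<in>R. poly q x = 0"
  shows "(\<Prod>x\<in>R. [:- x, 1:]) dvd q"
  using assms
proof (induction R rule: finite_induct)
  case (insert a R)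
  then obtain s where s: "q = (\<Prod>x\<in>R. [:- x, 1:]) * s" by (auto elim: dvdE)
  have "poly (\<Prod>x\<in>R. [:- x, 1:]) a \<noteq> 0" using insert.hyps by (auto simp: poly_prod)
  moreover have "poly q a = 0" using insert.prems by simp
  ultimately have "[:- a, 1:] dvd s" by (simp add: s poly_eq_0_iff_dvd)
  then have "[:- a, 1:] * (\<Prod>x\<in>R. [:- x, 1:]) dvd s * (\<Prod>x\<in>R. [:- x, 1:])"
    by (rule mult_dvd_mono) simp
  then show ?case using insert.hyps by (simp add: s mult.commute[of s] del: mult_pCons_left)
qed simp

text \<open>Over the complex numbers \<open>p\<close> is a constant times a product of distinct
  linear factors, so divisibility can be tested at the roots.\<close>

lemma rsquarefree_dvd_iff:
  fixes p q :: "complex poly"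
  assumes "rsquarefree p"
  shows "p dvd q \<longleftrightarrow> (\<forall>x. poly p x = 0 \<longrightarrow> poly q x = 0)"
proof
  assume q: "\<forall>x. poly p x = 0 \<longrightarrow> poly q x = 0"
  have "p \<noteq> 0" using assms by (simp add: rsquarefree_def)
  define R where "R = {x. poly p x = 0}"
  have "finite R" using \<open>p \<noteq> 0\<close> by (simp add: R_def poly_roots_finite)
  moreover have "\<forall>x\<in>R. poly q x = 0" using q by (simp add: R_def)
  ultimately have "(\<Prod>x\<in>R. [:- x, 1:]) dvd q"
    by (rule prod_linear_dvd)
  moreover have "p = smult (lead_coeff p) (\<Prod>x\<in>R. [:- x, 1:])"
    using complex_poly_decompose_rsquarefree[OF assms] by (simp add: R_def)
  ultimately show "p dvd q"
    using \<open>p \<noteq> 0\<close> by (metis leading_coeff_0_iff smult_dvd)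
qed auto

text \<open>A nonconstant common factor of \<open>p\<close> and its derivative has a root, which
  would be a multiple root of \<open>p\<close>.\<close>

lemma rsquarefree_bezout:
  fixes p :: "complex poly"
  assumes "rsquarefree p"
  obtains u v where "u * p + v * pderiv p = 1"
proof -
  have "coprime p (pderiv p)"
  proof (rule coprimeI)
    fix g assume g: "g dvd p" "g dvd pderiv p"
    have "g \<noteq> 0" using g assms by (auto simp: rsquarefree_def)
    moreover have "degree g = 0"
    proof (rule ccontr)
      assume "degree g \<noteq> 0"
      then obtain x where "poly g x = 0"
        using fundamental_theorem_of_algebra[of g] by (auto simp: constant_degree)
      with g have "poly p x = 0" "poly (pderiv p) x = 0" by (auto elim!: dvdE)
      with assms show False by (auto simp: rsquarefree_roots)
    qed
    ultimately show "is_unit g" by (simp add: is_unit_iff_degree)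
  qed
  then have "fst (bezout_coefficients p (pderiv p)) * p + snd (bezout_coefficients p (pderiv p)) * pderiv p = 1"
    by (simp add: bezout_coefficients_fst_snd)
  then show ?thesis by (rule that)
qed

text \<open>The map sending \<open>q\<close> to the Wronskian of \<open>q\<close> and \<open>C\<close> is onto the polynomials \<open>b\<close> for which
  \<open>b / C\<^sup>2\<close> has no residues; it replaces the residue theorem in the exclusion of the degree
  \<open>2 * degree C - 1\<close>.\<close>

lemma residue_free_imp_wronskian:
  fixes C b :: "complex poly"
  assumes sf: "rsquarefree C"
    and res: "\<And>x. poly C x = 0 \<Longrightarrow> poly (pderiv b * pderiv C) x = poly (b * pderiv (pderiv C)) x"
  obtains q where "b = pderiv C * q - C * pderiv q"
proof -
  obtain u v where uv: "u * C + v * pderiv C = 1" using rsquarefree_bezout[OF sf] .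
  define q r where "q = b * v" and "r = b * u"
  have b: "b = pderiv C * q + C * r"
  proof -
    have "b = b * (u * C + v * pderiv C)" by (simp add: uv)
    then show ?thesis by (simp add: q_def r_def algebra_simps)
  qed
  \<comment> \<open>At a root of \<open>C\<close> the decomposition gives \<open>b = C' q\<close>
    and \<open>b' = C'' q + C' (q' + r)\<close>, hence
    \<open>b' C' - b C'' = C'^2 (q' + r)\<close>.\<close>
  have "C dvd pderiv q + r"
    unfolding rsquarefree_dvd_iff[OF sf]
  proof (intro allI impI)
    fix x assume x: "poly C x = 0"
    then have x': "poly (pderiv C) x \<noteq> 0" using sf by (auto simp: rsquarefree_roots)
    have "poly (pderiv C) x ^ 2 * poly (pderiv q + r) x = 0"
      using res[OF x] x
      by (simp add: b pderiv_add pderiv_mult algebra_simps power2_eq_square)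
    with x' show "poly (pderiv q + r) x = 0" by simp
  qed
  then obtain s where s: "pderiv q + r = C * s" by (elim dvdE)
  \<comment> \<open>Replacing \<open>q\<close> by \<open>q + C t\<close> subtracts
    \<open>C^2 t'\<close> from the Wronskian, so \<open>t' = - s\<close> supplies exactly the
    missing \<open>C (q' + r)\<close>.\<close>
  define t where "t = poly_integral (- s)"
  have "b = pderiv C * (q + C * t) - C * pderiv (q + C * t)"
  proof -
    have "pderiv t = - s" by (simp add: t_def)
    moreover have "r = C * s - pderiv q" using s by (metis add_diff_cancel_left')
    ultimately show ?thesis by (simp add: b pderiv_add pderiv_mult ring_distribs)
  qed
  then show ?thesis using that by blast
qed

lemma coeff_mult_degree_le:
  "degree p \<le> m \<Longrightarrow> degree q \<le> n \<Longrightarrow> coeff (p * q) (m + n) = coeff p m * coeff q n"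
  for p q :: "'a::comm_semiring_0 poly"
proof -
  assume *: "degree p \<le> m" "degree q \<le> n"
  have "coeff (p * q) (m + n) = (\<Sum>i\<le>m + n. if i = m then coeff p m * coeff q n else 0)"
    unfolding coeff_mult
  proof (rule sum.cong[OF refl])
    fix i
    consider "i < m" | "i = m" | "m < i" by linarith
    then show "coeff p i * coeff q (m + n - i) = (if i = m then coeff p m * coeff q n else 0)"
      using * by cases (auto simp: coeff_eq_0)
  qed
  then show ?thesis by simp
qed

text \<open>With upper bounds in place of exact degrees this is the formal leading coefficient; the
  factor \<open>n - j\<close> cancels it when the bounds agree.\<close>

lemma coeff_wronskian:
  fixes C q :: "'a::{idom,ring_char_0} poly"
  assumes "degree C \<le> n" "degree q \<le> j" "0 < n + j"
  shows "coeff (pderiv C * q - C * pderiv q) (n + j - 1) = (of_nat n - of_nat j) * coeff C n * coeff q j"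
proof -
  have "coeff (pderiv p * r) (k + l - 1) = of_nat k * coeff p k * coeff r l"
    if "degree p \<le> k" "degree r \<le> l" "0 < k + l" for p r :: "'a poly" and k l
  proof (cases k)
    case 0
    with that have "pderiv p = 0" by (simp add: pderiv_eq_0_iff)
    with 0 show ?thesis by simp
  next
    case (Suc k')
    have "degree (pderiv p) \<le> k'" using that Suc by (simp add: degree_pderiv)
    then show ?thesis
      using coeff_mult_degree_le[of "pderiv p" k' r l] that Suc by (simp add: coeff_pderiv)
  qed
  from this[of C n q j] this[of q j C n] assms
  have "coeff (pderiv C * q) (n + j - 1) = of_nat n * coeff C n * coeff q j"
    "coeff (C * pderiv q) (n + j - 1) = of_nat j * coeff q j * coeff C n"
    by (simp_all add: add.commute mult.commute[of C])
  then show ?thesis by (simp add: left_diff_distrib)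
qed

lemma degree_wronskian:
  fixes C q :: "'a::{idom,ring_char_0} poly"
  assumes "C \<noteq> 0" "q \<noteq> 0" "degree q \<noteq> degree C"
  shows "degree (pderiv C * q - C * pderiv q) = degree C + degree q - 1"
proof -
  have pos: "0 < degree C + degree q" using assms by linarith
  have "coeff (pderiv C * q - C * pderiv q) (degree C + degree q - 1) \<noteq> 0"
    using assms by (subst coeff_wronskian[OF order_refl order_refl pos]) simp
  moreover have "degree (pderiv p * r) \<le> degree p + degree r - 1" for p r :: "'a poly"
  proof (cases "degree p = 0")
    case True
    then have "pderiv p = 0" by (simp add: pderiv_eq_0_iff)
    then show ?thesis by simp
  next
    case False
    then show ?thesis using degree_mult_le[of "pderiv p" r] by (simp add: degree_pderiv)
  qed
  from this[of C q] this[of q C]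
  have "degree (pderiv C * q - C * pderiv q) \<le> degree C + degree q - 1"
    by (intro degree_diff_le) (simp_all add: mult.commute add.commute)
  ultimately show ?thesis by (intro antisym le_degree)
qed

text \<open>\<open>b\<close> is a Wronskian of some \<open>q\<close> and \<open>C\<close>. If their
  degrees agree, the coefficient at \<open>2 * degree C - 1\<close> cancels; otherwise the degree is
  \<open>degree C + degree q - 1\<close>, a different number.\<close>

lemma residue_free_degree:
  fixes C b :: "complex poly"
  assumes sf: "rsquarefree C" and "0 < degree C"
    and res: "\<And>x. poly C x = 0 \<Longrightarrow> poly (pderiv b * pderiv C) x = poly (b * pderiv (pderiv C)) x"
  shows "degree b \<noteq> 2 * degree C - 1"
proof
  assume deg: "degree b = 2 * degree C - 1"
  obtain q where q: "b = pderiv C * q - C * pderiv q"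
    using residue_free_imp_wronskian[OF sf res] by blast
  have "C \<noteq> 0" using sf by (simp add: rsquarefree_def)
  have "q \<noteq> 0" using q deg \<open>0 < degree C\<close> by auto
  show False
  proof (cases "degree q = degree C")
    case True
    then have "coeff b (2 * degree C - 1) = 0"
      using coeff_wronskian[of C "degree C" q "degree C"] \<open>0 < degree C\<close> by (simp add: q mult_2)
    with deg have "b = 0" by (metis leading_coeff_0_iff)
    then show False using deg \<open>0 < degree C\<close> by simp
  next
    case False
    then have "degree b = degree C + degree q - 1"
      using degree_wronskian[of C q] \<open>C \<noteq> 0\<close> \<open>q \<noteq> 0\<close> by (simp add: q)
    with deg False \<open>0 < degree C\<close> show False by simp
  qed
qed

section \<open>Forms in two variables on the circle\<close>

lemma eval2_simps [simp]:
  "eval2 0 x = 0" "eval2 1 x = 1"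
  "eval2 (p + q) x = eval2 p x + eval2 q x"
  "eval2 (p - q) x = eval2 p x - eval2 q x"
  "eval2 (- p) x = - eval2 p x"
  "eval2 (p * q) x = eval2 p x * eval2 q x"
  "eval2 (p ^ l) x = eval2 p x ^ l"
  "eval2 (scale2 c p) x = c * eval2 p x"
  by (simp_all add: eval2_def scale2_def)

lemma eval2_sum [simp]: "eval2 (\<Sum>i\<in>A. p i) x = (\<Sum>i\<in>A. eval2 (p i) x)"
  by (simp add: eval2_def poly_sum)

lemma eval2_pCons: "eval2 (pCons c p) x = poly c (fst x) + snd x * eval2 p x"
  by (simp add: eval2_def)

lemma eval2_monom: "eval2 (monom (monom c i) j) x = c * fst x ^ i * snd x ^ j"
  by (simp add: eval2_def poly_monom)

lemma homogeneous2_subspace: "cpoly2.subspace (homogeneous2 k)"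
proof (rule cpoly2.subspaceI)
  fix p q assume "p \<in> homogeneous2 k" "q \<in> homogeneous2 k"
  moreover have "coeff (coeff p j) i \<noteq> 0 \<or> coeff (coeff q j) i \<noteq> 0"
    if "coeff (coeff (p + q) j) i \<noteq> 0" for i j using that by auto
  ultimately show "p + q \<in> homogeneous2 k" unfolding homogeneous2_def by blast
qed (auto simp: homogeneous2_def scale2_def)

lemma coeff2_mult_nonzero:
  assumes "coeff (coeff (p * q) j) i \<noteq> 0"
  obtains i1 j1 i2 j2 where "i = i1 + i2" "j = j1 + j2"
    "coeff (coeff p j1) i1 \<noteq> 0" "coeff (coeff q j2) i2 \<noteq> (0::'a::comm_semiring_0)"
proof -
  have "(\<Sum>l\<le>j. coeff (coeff p l * coeff q (j - l)) i) \<noteq> 0"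
    using assms by (simp add: coeff_mult[of p] coeff_sum)
  then obtain l where l: "l \<le> j" "coeff (coeff p l * coeff q (j - l)) i \<noteq> 0"
    by (meson atMost_iff sum.neutral)
  then obtain h where h: "h \<le> i" "coeff (coeff p l) h * coeff (coeff q (j - l)) (i - h) \<noteq> 0"
    unfolding coeff_mult by (meson atMost_iff sum.neutral)
  show ?thesis
  proof (rule that)
    show "i = h + (i - h)" "j = l + (j - l)" using l h by simp_all
    show "coeff (coeff p l) h \<noteq> 0" "coeff (coeff q (j - l)) (i - h) \<noteq> 0"
      using h(2) by auto
  qed
qed

lemma homogeneous2_mult:
  assumes "p \<in> homogeneous2 k" "q \<in> homogeneous2 l"
  shows "p * q \<in> homogeneous2 (k + l)"
proof -
  have "i + j = k + l" if nz: "coeff (coeff (p * q) j) i \<noteq> 0" for i j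
  proof -
    obtain i1 j1 i2 j2 where "i = i1 + i2" "j = j1 + j2"
      "coeff (coeff p j1) i1 \<noteq> 0" "coeff (coeff q j2) i2 \<noteq> 0"
      using coeff2_mult_nonzero[OF nz] .
    moreover from this have "i1 + j1 = k" "i2 + j2 = l"
      using assms unfolding homogeneous2_def by blast+
    ultimately show ?thesis by simp
  qed
  then show ?thesis by (simp add: homogeneous2_def)
qed

lemma homogeneous2_1: "1 \<in> homogeneous2 0"
  by (simp add: homogeneous2_def coeff_1)

lemma homogeneous2_power: "p \<in> homogeneous2 k \<Longrightarrow> p ^ l \<in> homogeneous2 (k * l)"
proof (induction l)
  case (Suc l)
  then show ?case using homogeneous2_mult[of p k "p ^ l" "k * l"] by simp
qed (simp add: homogeneous2_1)

lemma homogeneous2_expand: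
  assumes "p \<in> homogeneous2 k"
  shows "p = (\<Sum>j\<le>k. monom (monom (coeff (coeff p j) (k - j)) (k - j)) j)"
proof (intro poly_eqI)
  fix j i
  have *: "coeff (coeff p j) i = 0" if "i + j \<noteq> k"
    using assms that unfolding homogeneous2_def by blast
  show "coeff (coeff p j) i
    = coeff (coeff (\<Sum>j\<le>k. monom (monom (coeff (coeff p j) (k - j)) (k - j)) j) j) i"
  proof (cases "j \<le> k")
    case True
    then show ?thesis
      using * by (auto simp: coeff_sum sum.If_cases if_distrib[of "\<lambda>q. coeff q i"] cong: if_cong)
  next
    case False
    then have "coeff (\<Sum>j\<le>k. monom (monom (coeff (coeff p j) (k - j)) (k - j)) j) j = 0"
      by (auto simp: coeff_sum intro!: sum.neutral)
    with False * show ?thesis by simp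
  qed
qed

lemma eval2_homogeneous2:
  assumes "p \<in> homogeneous2 k"
  shows "eval2 p x = (\<Sum>j\<le>k. coeff (coeff p j) (k - j) * fst x ^ (k - j) * snd x ^ j)"
  by (subst homogeneous2_expand[OF assms]) (simp add: eval2_monom)

lemma eval2_homogeneous2_scale:
  assumes "p \<in> homogeneous2 k"
  shows "eval2 p (t * u, t * v) = t ^ k * eval2 p (u, v)"
proof -
  have "(t * u) ^ (k - j) * (t * v) ^ j = t ^ k * (u ^ (k - j) * v ^ j)" if "j \<le> k" for j
  proof -
    have "t ^ k = t ^ (k - j) * t ^ j" using that by (simp flip: power_add)
    then show ?thesis by (simp add: power_mult_distrib)
  qed
  then show ?thesis
    by (simp add: eval2_homogeneous2[OF assms] sum_distrib_left mult.assoc mult.left_commute[of _ "t ^ k"])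
qed

text \<open>Complex angles reach the whole complex conic: \<open>Arccos x\<close> fixes the cosine,
  and its negative corrects the sign of the sine.\<close>

lemma complex_circle_param:
  fixes x y :: complex
  assumes "x\<^sup>2 + y\<^sup>2 = 1"
  obtains \<theta> where "x = cos \<theta>" "y = sin \<theta>"
proof -
  have "sin (Arccos x) ^ 2 = y\<^sup>2"
    using assms sin_cos_squared_add2[of "Arccos x"] by (metis add_diff_cancel_left' cos_Arccos)
  then consider "y = sin (Arccos x)" | "y = sin (- Arccos x)"
    by (auto simp: power2_eq_iff)
  then show ?thesis
  proof cases
    case 1
    then show ?thesis by (intro that[of "Arccos x"]) simp_all
  next
    case 2
    then show ?thesis by (intro that[of "- Arccos x"]) simp_all
  qed
qed

text \<open>A form of degree \<open>k\<close> is determined by its values at the points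
  \<open>(u, 1)\<close>, and for \<open>u^2 + 1\<close> nonzero such a point is a multiple of some
  \<open>(- sin \<theta>, cos \<theta>)\<close>. Multiplying by \<open>1 + u^2\<close> absorbs the
  two exceptional values of \<open>u\<close>.\<close>

lemma homogeneous2_eq_0:
  assumes p: "p \<in> homogeneous2 k" and zero: "\<And>\<theta>. eval2 p (- sin \<theta>, cos \<theta>) = 0"
  shows "p = 0"
proof -
  define Q where "Q = (\<Sum>j\<le>k. monom (coeff (coeff p j) (k - j)) (k - j))"
  have Q: "poly Q u = eval2 p (u, 1)" for u
    by (simp add: Q_def eval2_homogeneous2[OF p] poly_sum poly_monom)
  have Q': "poly (Q * [:1, 0, 1:]) u = poly Q u * (u\<^sup>2 + 1)" for u
    by (simp add: algebra_simps power2_eq_square)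
  have "poly (Q * [:1, 0, 1:]) u = 0" for u
  proof (cases "u\<^sup>2 + 1 = 0")
    case True
    then show ?thesis unfolding Q' by simp
  next
    case False
    define r where "r = csqrt (u\<^sup>2 + 1)"
    have r: "r\<^sup>2 = u\<^sup>2 + 1" "r \<noteq> 0" using False by (auto simp: r_def)
    have "(1 / r)\<^sup>2 + (- u / r)\<^sup>2 = 1"
      using False r by (simp add: power_divide add.commute flip: add_divide_distrib)
    then obtain \<theta> where \<theta>: "1 / r = cos \<theta>" "- u / r = sin \<theta>" by (rule complex_circle_param)
    have "1 / r * u = - sin \<theta>" by (subst \<theta>(2)[symmetric]) simp
    moreover have "1 / r * 1 = cos \<theta>" using \<theta>(1) by simp
    ultimately have "eval2 p (1 / r * u, 1 / r * 1) = 0" using zero[of \<theta>] by (simp only:)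
    then have "poly Q u = 0" using r unfolding eval2_homogeneous2_scale[OF p] by (simp add: Q)
    then show ?thesis unfolding Q' by simp
  qed
  then have "Q * [:1, 0, 1:] = 0" by (metis poly_all_0_iff_0)
  then have "Q = 0" unfolding mult_eq_0_iff by simp
  have "coeff (coeff p j) (k - j) = 0" if "j \<le> k" for j
  proof -
    have "coeff Q (k - j) = (\<Sum>l\<le>k. if l = j then coeff (coeff p j) (k - j) else 0)"
      unfolding Q_def coeff_sum using that by (intro sum.cong) auto
    with \<open>Q = 0\<close> that show ?thesis by simp
  qed
  then show ?thesis by (subst homogeneous2_expand[OF p]) simp
qed

section \<open>Directional derivatives of forms\<close>

lemma dir_deriv_pCons:
  "dir_deriv a (pCons c p) =
     pCons (smult (fst a) (pderiv c)) 0 + scale2 (snd a) p + pCons 0 (dir_deriv a p)"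
  by (simp add: dir_deriv_def scale2_def map_poly_pCons pderiv_pCons smult_add_right)

lemma eval2_has_field_derivative:
  assumes "(u has_field_derivative u') (at t)" "(v has_field_derivative v') (at t)"
  shows "((\<lambda>t. eval2 p (u t, v t)) has_field_derivative eval2 (dir_deriv (u', v') p) (u t, v t)) (at t)"
proof (induction p)
  case 0
  then show ?case by (simp add: dir_deriv_def)
next
  case (pCons c p)
  have "((\<lambda>t. poly c (u t)) has_field_derivative poly (pderiv c) (u t) * u') (at t)"
    using DERIV_chain2[OF poly_DERIV assms(1)] .
  from DERIV_add[OF this DERIV_mult[OF assms(2) pCons.IH]] show ?case
    by (simp add: eval2_pCons dir_deriv_pCons algebra_simps)
qed

lemma dir_deriv_scale: "dir_deriv (c * a, c * b) p = scale2 c (dir_deriv (a, b) p)"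
  by (simp add: dir_deriv_def scale2_def smult_add_right mult.commute)

text \<open>For \<open>k = 0\<close> the truncated \<open>k - 1\<close> does no harm, since
  constants have derivative 0.\<close>

lemma dir_deriv_homogeneous2:
  assumes "p \<in> homogeneous2 k"
  shows "dir_deriv a p \<in> homogeneous2 (k - 1)"
proof -
  have H: "i + j = k" if "coeff (coeff p j) i \<noteq> 0" for i j
    using assms that unfolding homogeneous2_def by blast
  have "map_poly pderiv p \<in> homogeneous2 (k - 1)"
    unfolding homogeneous2_def
    by (force simp: coeff_map_poly coeff_pderiv dest: H)
  moreover have "pderiv p \<in> homogeneous2 (k - 1)"
    unfolding homogeneous2_def by (force simp: coeff_pderiv of_nat_poly dest: H)
  ultimately show ?thesis unfolding dir_deriv_def
    using homogeneous2_subspace by (intro cpoly2.subspace_add cpoly2.subspace_scale)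
qed

text \<open>The point \<open>(- sin \<theta>, cos \<theta>)\<close> moves with velocity
  \<open>- (cos \<theta>, sin \<theta>)\<close>, so the derivative normal to its line is, up to
  sign, a derivative in \<theta>.\<close>

lemma dir_deriv_circle:
  "((\<lambda>\<theta>. eval2 p (- sin \<theta>, cos \<theta>)) has_field_derivative
     - eval2 (dir_deriv (cos \<theta>, sin \<theta>) p) (- sin \<theta>, cos \<theta>)) (at \<theta>)"
proof -
  have "((\<lambda>\<theta>. eval2 p (- sin \<theta>, cos \<theta>)) has_field_derivative
     eval2 (dir_deriv (- cos \<theta>, - sin \<theta>) p) (- sin \<theta>, cos \<theta>)) (at \<theta>)"
    by (intro eval2_has_field_derivative derivative_eq_intros) auto
  then show ?thesis using dir_deriv_scale[of "-1" "cos \<theta>" "sin \<theta>" p] by simp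
qed

lemma dir_deriv_x1_power:
  "coeff (coeff ((dir_deriv (1, 0) ^^ l) p) j) i = pochhammer (of_nat (Suc i)) l * coeff (coeff p j) (i + l)"
proof -
  have "(dir_deriv (1, 0) ^^ l) p = map_poly (pderiv ^^ l) p"
  proof (induction l)
    case (Suc l)
    then show ?case
      by (intro poly_eqI) (simp add: dir_deriv_def scale2_def coeff_map_poly)
  qed simp
  then show ?thesis by (simp add: coeff_map_poly coeff_higher_pderiv)
qed

text \<open>On the line \<open>x1 = 0\<close> the \<open>l\<close>-th derivative is
  \<open>l!\<close> times the coefficient of \<open>x1^l\<close>, viewed as a polynomial in
  \<open>x2\<close>.\<close>

lemma dir_deriv_x1_power_vanishes_iff:
  "(\<forall>x. bil (1, 0) x = 0 \<longrightarrow> eval2 ((dir_deriv (1, 0) ^^ l) p) x = 0) \<longleftrightarrow> (\<forall>j. coeff (coeff p j) l = 0)"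
proof -
  define q where "q = (dir_deriv (1, 0) ^^ l) p"
  define q0 where "q0 = map_poly (\<lambda>r. coeff r 0) q"
  have "eval2 q (0, y) = poly q0 y" for y
    unfolding q0_def by (induction q) (simp_all add: eval2_pCons map_poly_pCons poly_0_coeff_0)
  then have "(\<forall>x. bil (1, 0) x = 0 \<longrightarrow> eval2 q x = 0) \<longleftrightarrow> (\<forall>y. poly q0 y = 0)"
    by (auto simp: bil_def)
  also have "\<dots> \<longleftrightarrow> q0 = 0" by (rule poly_all_0_iff_0)
  also have "\<dots> \<longleftrightarrow> (\<forall>j. coeff (coeff p j) l = 0)"
    by (simp add: poly_eq_iff q0_def coeff_map_poly q_def dir_deriv_x1_power flip: pochhammer_fact)
  finally show ?thesis by (simp add: q_def)
qed

section \<open>Normal form of the forms satisfying the conditions for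
  \<open>\<alpha>\<^sub>0\<close>\<close>

definition X1 :: cpoly2 where "X1 = monom (monom 1 1) 0"
definition X2 :: cpoly2 where "X2 = monom 1 1"

text \<open>On the points \<open>(- sin \<theta>, cos \<theta>)\<close> these forms of degree \<open>k\<close> restrict to \<open>cos\<^sup>j \<theta>\<close> and
  \<open>- sin\<^bsup>2m+1\<^esup> \<theta> cos\<^sup>j \<theta>\<close>; the odd case is meaningful only if \<open>2 * m + 1 + j \<le> k\<close>.\<close>

definition circle_basis :: "nat \<Rightarrow> nat \<Rightarrow> nat \<Rightarrow> cpoly2" where
  "circle_basis m k j =
     (if even (k + j) then X2 ^ j * (X1\<^sup>2 + X2\<^sup>2) ^ ((k - j) div 2)
      else X1 ^ (2 * m + 1) * (X2 ^ j * (X1\<^sup>2 + X2\<^sup>2) ^ ((k - (2 * m + 1 + j)) div 2)))"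

text \<open>One polynomial encodes both parts of a form: exponents with the parity of
  \<open>k\<close> give the part even in \<open>x1\<close>, the other exponents the part with the
  factor \<open>x1^(2m+1)\<close>.\<close>

definition homogenize :: "nat \<Rightarrow> nat \<Rightarrow> complex poly \<Rightarrow> cpoly2" where
  "homogenize m k y = (\<Sum>j\<le>k. scale2 (coeff y j) (circle_basis m k j))"

definition even_profiles :: "nat \<Rightarrow> complex poly set" where
  "even_profiles k = {a. \<forall>j. coeff a j \<noteq> 0 \<longrightarrow> even (k + j) \<and> j \<le> k}"

definition odd_profiles :: "nat \<Rightarrow> nat \<Rightarrow> complex poly set" where
  "odd_profiles m k = {b. \<forall>j. coeff b j \<noteq> 0 \<longrightarrow> odd (k + j) \<and> 2 * m + 1 + j \<le> k}"

lemma X1_power: "X1 ^ l = monom (monom 1 l) 0"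
  by (simp add: X1_def monom_power)

lemma X2_power: "X2 ^ l = monom 1 l"
  by (simp add: X2_def monom_power)

lemma eval2_X1 [simp]: "eval2 X1 x = fst x"
  by (simp add: X1_def eval2_monom)

lemma eval2_X2 [simp]: "eval2 X2 x = snd x"
  using eval2_monom[of 1 0 1] by (simp add: X2_def)

lemma homogenize_linear: "Vector_Spaces.linear smult scale2 (homogenize m k)"
  unfolding Vector_Spaces.linear_iff
proof (intro conjI allI)
  show "homogenize m k (p + q) = homogenize m k p + homogenize m k q" for p q
    by (simp add: homogenize_def cpoly2.scale_left_distrib sum.distrib)
  show "homogenize m k (smult c p) = scale2 c (homogenize m k p)" for c p
    by (simp add: homogenize_def cpoly2.scale_sum_right)
qed unfold_locales

lemma homogenize_add: "homogenize m k (p + q) = homogenize m k p + homogenize m k q"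
  by (simp add: homogenize_def cpoly2.scale_left_distrib sum.distrib)

lemma coeff_subspace: "poly_vs.subspace {p :: 'a::field poly. \<forall>j. coeff p j \<noteq> 0 \<longrightarrow> P j}"
proof (rule poly_vs.subspaceI)
  fix p q :: "'a poly" assume "p \<in> {p. \<forall>j. coeff p j \<noteq> 0 \<longrightarrow> P j}" "q \<in> {p. \<forall>j. coeff p j \<noteq> 0 \<longrightarrow> P j}"
  moreover have "coeff p j \<noteq> 0 \<or> coeff q j \<noteq> 0" if "coeff (p + q) j \<noteq> 0" for j using that by auto
  ultimately show "p + q \<in> {p. \<forall>j. coeff p j \<noteq> 0 \<longrightarrow> P j}" by blast
qed auto

lemma even_profiles_subspace: "poly_vs.subspace (even_profiles k)"
  unfolding even_profiles_def by (rule coeff_subspace)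

lemma odd_profiles_subspace: "poly_vs.subspace (odd_profiles m k)"
  unfolding odd_profiles_def by (rule coeff_subspace)

lemma circle_basis_homogeneous2:
  assumes "even (k + j) \<and> j \<le> k \<or> odd (k + j) \<and> 2 * m + 1 + j \<le> k"
  shows "circle_basis m k j \<in> homogeneous2 k"
proof -
  have X: "X1 \<in> homogeneous2 1" "X2 \<in> homogeneous2 1"
    by (auto simp: homogeneous2_def X1_def X2_def coeff_1)
  then have "X1\<^sup>2 \<in> homogeneous2 2" "X2\<^sup>2 \<in> homogeneous2 2"
    using homogeneous2_power[of _ 1 2] by simp_all
  then have "X1\<^sup>2 + X2\<^sup>2 \<in> homogeneous2 2"
    using homogeneous2_subspace by (intro cpoly2.subspace_add)
  then have "X2 ^ j * (X1\<^sup>2 + X2\<^sup>2) ^ l \<in> homogeneous2 (j + 2 * l)" for l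
    using homogeneous2_mult[OF homogeneous2_power[OF X(2), of j] homogeneous2_power[of _ 2 l]] by simp
  moreover from this have
    "X1 ^ (2 * m + 1) * (X2 ^ j * (X1\<^sup>2 + X2\<^sup>2) ^ l) \<in> homogeneous2 (2 * m + 1 + (j + 2 * l))" for l
    using homogeneous2_mult[OF homogeneous2_power[OF X(1), of "2 * m + 1"]] by (simp only: mult_1)
  moreover have "j + 2 * ((k - j) div 2) = k" if "even (k + j)" "j \<le> k"
  proof -
    have "even (k - j)" using that by simp
    then show ?thesis using that(2) by simp
  qed
  moreover have "2 * m + 1 + (j + 2 * ((k - (2 * m + 1 + j)) div 2)) = k"
    if "odd (k + j)" "2 * m + 1 + j \<le> k"
  proof -
    have "even (k - (2 * m + 1 + j))" using that by simp
    then show ?thesis using that(2) by simp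
  qed
  ultimately show ?thesis using assms unfolding circle_basis_def by metis
qed

lemma homogenize_homogeneous2:
  assumes "\<And>j. coeff y j \<noteq> 0 \<Longrightarrow> even (k + j) \<and> j \<le> k \<or> odd (k + j) \<and> 2 * m + 1 + j \<le> k"
  shows "homogenize m k y \<in> homogeneous2 k"
  unfolding homogenize_def
proof (intro cpoly2.subspace_sum homogeneous2_subspace)
  fix j
  show "scale2 (coeff y j) (circle_basis m k j) \<in> homogeneous2 k"
  proof (cases "coeff y j = 0")
    case True
    then show ?thesis using homogeneous2_subspace cpoly2.subspace_0 by simp
  next
    case False
    then show ?thesis
      using assms homogeneous2_subspace by (intro cpoly2.subspace_scale circle_basis_homogeneous2)
  qed
qed

lemma homogenize_even_homogeneous2: "a \<in> even_profiles k \<Longrightarrow> homogenize m k a \<in> homogeneous2 k"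
  by (intro homogenize_homogeneous2) (auto simp: even_profiles_def simp del: even_add)

lemma homogenize_odd_homogeneous2: "b \<in> odd_profiles m k \<Longrightarrow> homogenize m k b \<in> homogeneous2 k"
  by (intro homogenize_homogeneous2) (auto simp: odd_profiles_def simp del: even_add)

lemma poly_eq_sum_atMost:
  fixes p :: "'a::comm_semiring_1 poly"
  assumes "\<And>j. coeff p j \<noteq> 0 \<Longrightarrow> j \<le> k"
  shows "poly p x = (\<Sum>j\<le>k. coeff p j * x ^ j)"
proof -
  have "degree p \<le> k" using assms by (meson degree_le not_le)
  then show ?thesis unfolding poly_altdef[of p]
    by (intro sum.mono_neutral_left) (auto simp: coeff_eq_0)
qed

lemma homogenize_even_circle:
  assumes "a \<in> even_profiles k"
  shows "eval2 (homogenize m k a) (- sin \<theta>, cos \<theta>) = poly a (cos \<theta>)"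
proof -
  have "coeff a j * eval2 (circle_basis m k j) (- sin \<theta>, cos \<theta>) = coeff a j * cos \<theta> ^ j" for j
  proof (cases "coeff a j = 0")
    case False
    then have "even (k + j)" using assms unfolding even_profiles_def by blast
    then show ?thesis by (simp add: circle_basis_def del: even_add)
  qed simp
  moreover have "poly a (cos \<theta>) = (\<Sum>j\<le>k. coeff a j * cos \<theta> ^ j)"
    using assms by (intro poly_eq_sum_atMost) (auto simp: even_profiles_def)
  ultimately show ?thesis by (simp only: homogenize_def eval2_sum eval2_simps)
qed

lemma homogenize_odd_circle:
  assumes "b \<in> odd_profiles m k"
  shows "eval2 (homogenize m k b) (- sin \<theta>, cos \<theta>) = - (sin \<theta> ^ (2 * m + 1)) * poly b (cos \<theta>)"
proof -
  have "coeff b j * eval2 (circle_basis m k j) (- sin \<theta>, cos \<theta>)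
      = - (sin \<theta> ^ (2 * m + 1)) * (coeff b j * cos \<theta> ^ j)" for j
  proof (cases "coeff b j = 0")
    case False
    then have "odd (k + j)" using assms unfolding odd_profiles_def by blast
    then have "circle_basis m k j
        = X1 ^ (2 * m + 1) * (X2 ^ j * (X1\<^sup>2 + X2\<^sup>2) ^ ((k - (2 * m + 1 + j)) div 2))"
      by (simp only: circle_basis_def if_False)
    then show ?thesis by simp
  qed simp
  moreover have "poly b (cos \<theta>) = (\<Sum>j\<le>k. coeff b j * cos \<theta> ^ j)"
    using assms by (intro poly_eq_sum_atMost) (auto simp: odd_profiles_def)
  ultimately show ?thesis by (simp only: homogenize_def eval2_sum eval2_simps sum_distrib_left)
qed

text \<open>The cosine is onto the complex numbers, and \<open>sin \<theta> = 0\<close> excludes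
  only its values 1 and -1, which the factor \<open>1 - x^2\<close> covers.\<close>

lemma poly_cos_sin_eq_0:
  assumes "\<And>\<theta>. sin \<theta> \<noteq> 0 \<Longrightarrow> poly p (cos \<theta>) = (0 :: complex)"
  shows "p = 0"
proof -
  have "poly (p * [:1, 0, -1:]) x = 0" for x
  proof (cases "sin (Arccos x) = 0")
    case True
    then have "x\<^sup>2 = 1" using sin_cos_squared_add[of "Arccos x"] by simp
    then show ?thesis by (simp add: power2_eq_square)
  next
    case False
    then show ?thesis using assms[of "Arccos x"] by simp
  qed
  then have "p * [:1, 0, -1:] = 0" by (metis poly_all_0_iff_0)
  then show ?thesis unfolding mult_eq_0_iff by simp
qed

text \<open>Changing the sign of \<theta> keeps the first term and reverses the second, so both
  vanish separately.\<close>

lemma even_odd_circle_eq_0: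
  assumes "\<And>\<theta>. poly a (cos \<theta>) - sin \<theta> ^ (2 * m + 1) * poly b (cos \<theta>) = (0 :: complex)"
  shows "a = 0" "b = 0"
proof -
  have *: "poly a (cos \<theta>) = 0 \<and> sin \<theta> ^ (2 * m + 1) * poly b (cos \<theta>) = 0" for \<theta>
    using assms[of \<theta>] assms[of "- \<theta>"] by (auto simp: eq_neg_iff_add_eq_0)
  show "a = 0" using * by (intro poly_cos_sin_eq_0) blast
  show "b = 0"
  proof (rule poly_cos_sin_eq_0)
    fix \<theta> :: complex assume "sin \<theta> \<noteq> 0"
    with *[of \<theta>] show "poly b (cos \<theta>) = 0" by simp
  qed
qed

text \<open>The conditions for \<open>\<alpha>\<^sub>0 = (1, 0)\<close> translated by
  \<open>dir_deriv_x1_power_vanishes_iff\<close>: no odd power of \<open>x1\<close> below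
  \<open>x1^(2m+1)\<close> occurs.\<close>

definition x1_quasi_invariant :: "nat \<Rightarrow> cpoly2 \<Rightarrow> bool" where
  "x1_quasi_invariant m p \<longleftrightarrow> (\<forall>s\<in>{1..m}. \<forall>j. coeff (coeff p j) (2 * s - 1) = 0)"

lemma circle_basis_x1_quasi_invariant: "x1_quasi_invariant m (circle_basis m k j)"
proof -
  have X: "even i" if "coeff (coeff (X2 ^ j) h) i \<noteq> 0" for h i j
    using that by (auto simp: X2_power split: if_splits)
  have "even i" if "coeff (coeff (X1\<^sup>2 + X2\<^sup>2) h) i \<noteq> 0" for h i
    using that by (auto simp: X1_power X2_power of_bool_def split: if_splits)
  then have R: "even i" if "coeff (coeff ((X1\<^sup>2 + X2\<^sup>2) ^ l) h) i \<noteq> 0" for h i l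
    using that
  proof (induction l arbitrary: h i)
    case (Suc l)
    then show ?case by (metis coeff2_mult_nonzero even_add power_Suc)
  qed (auto simp: of_bool_def split: if_splits)
  have XR: "even i" if "coeff (coeff (X2 ^ j * (X1\<^sup>2 + X2\<^sup>2) ^ l) h) i \<noteq> 0" for h i l
    using that coeff2_mult_nonzero X R by (metis even_add)
  have "2 * m + 1 \<le> i" if nz: "coeff (coeff (X1 ^ (2 * m + 1) * q) h) i \<noteq> 0" for h i q
  proof -
    obtain i1 j1 i2 j2 where "i = i1 + i2" "coeff (coeff (X1 ^ (2 * m + 1)) j1) i1 \<noteq> 0"
      using coeff2_mult_nonzero[OF nz] by metis
    then show ?thesis unfolding X1_power by (auto split: if_splits)
  qed
  then have Z: "coeff (coeff (X1 ^ (2 * m + 1) * q) h) i = 0" if "i < 2 * m + 1" for h i q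
    using that by (meson not_le)
  show ?thesis unfolding x1_quasi_invariant_def
  proof (intro ballI allI)
    fix s h assume "s \<in> {1..m}"
    then have s: "odd (2 * s - 1)" "2 * s - 1 < 2 * m + 1" by auto
    show "coeff (coeff (circle_basis m k j) h) (2 * s - 1) = 0"
    proof (cases "even (k + j)")
      case True
      show ?thesis unfolding circle_basis_def if_P[OF True] using XR s(1) by blast
    next
      case False
      show ?thesis unfolding circle_basis_def if_not_P[OF False]
        using Z s(2) by blast
    qed
  qed
qed

lemma homogenize_x1_quasi_invariant: "x1_quasi_invariant m (homogenize m k y)"
  using circle_basis_x1_quasi_invariant[of m k]
  by (simp add: x1_quasi_invariant_def homogenize_def coeff_sum scale2_def)

text \<open>Each monomial of \<open>p\<close> contains an even power of \<open>x1\<close> or an odd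
  power of exponent at least \<open>2 * m + 1\<close>. On the circle the even powers become
  polynomials in \<open>cos \<theta>\<close>, and two forms of degree \<open>k\<close> that agree
  there are equal.\<close>

lemma homogenize_surj:
  assumes p: "p \<in> homogeneous2 k" and x1: "x1_quasi_invariant m p"
  obtains a b where "a \<in> even_profiles k" "b \<in> odd_profiles m k" "p = homogenize m k (a + b)"
proof -
  define c where "c j = coeff (coeff p j) (k - j)" for j
  define A where "A = {j. j \<le> k \<and> even (k + j)}"
  define B where "B = {j. 2 * m + 1 + j \<le> k \<and> odd (k + j)}"
  \<comment> \<open>At \<open>cos \<theta>\<close> this polynomial takes the value of
    \<open>sin \<theta>\<close> squared, so it stands for \<open>x1^2\<close> on the circle.\<close>
  define W where "W = [:1, 0, -1 :: complex:]"
  define a where "a = (\<Sum>j\<in>A. smult (c j) (W ^ ((k - j) div 2) * monom 1 j))"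
  define b where "b = (\<Sum>j\<in>B. smult (c j) (W ^ ((k - (2 * m + 1 + j)) div 2) * monom 1 j))"
  have W: "coeff (W ^ l * monom 1 j) i \<noteq> 0 \<Longrightarrow> even (i + j) \<and> i \<le> 2 * l + j" for l j i
  proof -
    assume nz: "coeff (W ^ l * monom 1 j) i \<noteq> 0"
    have "has_parity 0 W" by (auto simp: has_parity_def W_def coeff_pCons split: nat.splits)
    then have "has_parity (0 + j) (W ^ l * monom 1 j)"
      using has_parity_power[of 0 W l] by (intro has_parity_mult has_parity_monom) auto
    then have "even (j + i)" using nz unfolding has_parity_def by simp
    moreover have "degree (W ^ l * monom 1 j) \<le> degree W * l + j"
      by (intro order.trans[OF degree_mult_le] add_mono degree_power_le degree_monom_le)
    then have "i \<le> 2 * l + j" using le_degree[OF nz] by (simp add: W_def)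
    ultimately show ?thesis by (simp add: add.commute)
  qed
  have "smult (c j) (W ^ ((k - j) div 2) * monom 1 j) \<in> even_profiles k" if "j \<in> A" for j
  proof -
    have "even (k + i) \<and> i \<le> k" if "coeff (W ^ ((k - j) div 2) * monom 1 j) i \<noteq> 0" for i
      using W[OF that] \<open>j \<in> A\<close> unfolding A_def by auto
    then show ?thesis by (simp add: even_profiles_def)
  qed
  then have a: "a \<in> even_profiles k"
    unfolding a_def by (intro poly_vs.subspace_sum even_profiles_subspace)
  have "smult (c j) (W ^ ((k - (2 * m + 1 + j)) div 2) * monom 1 j) \<in> odd_profiles m k" if "j \<in> B" for j
  proof -
    have "odd (k + i) \<and> 2 * m + 1 + i \<le> k"
      if "coeff (W ^ ((k - (2 * m + 1 + j)) div 2) * monom 1 j) i \<noteq> 0" for i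
      using W[OF that] \<open>j \<in> B\<close> unfolding B_def by auto
    then show ?thesis by (simp add: odd_profiles_def)
  qed
  then have b: "b \<in> odd_profiles m k"
    unfolding b_def by (intro poly_vs.subspace_sum odd_profiles_subspace)
  have "eval2 p (- sin \<theta>, cos \<theta>) = poly a (cos \<theta>) - sin \<theta> ^ (2 * m + 1) * poly b (cos \<theta>)" for \<theta>
  proof -
    have W_cos: "poly W (cos \<theta>) = (sin \<theta>)\<^sup>2"
      using sin_squared_eq[of \<theta>] by (simp add: W_def power2_eq_square)
    have "finite B" unfolding B_def by (rule finite_subset[of _ "{..k}"]) auto
    have "poly a (cos \<theta>) = (\<Sum>j\<in>A. c j * (- sin \<theta>) ^ (k - j) * cos \<theta> ^ j)"
      unfolding a_def poly_sum
      by (intro sum.cong) (auto simp: A_def poly_monom W_cos simp flip: power_mult)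
    moreover have "- (sin \<theta> ^ (2 * m + 1)) * poly b (cos \<theta>) = (\<Sum>j\<in>B. c j * (- sin \<theta>) ^ (k - j) * cos \<theta> ^ j)"
      unfolding b_def poly_sum sum_distrib_left
    proof (intro sum.cong refl)
      fix j assume j: "j \<in> B"
      define l where "l = (k - (2 * m + 1 + j)) div 2"
      have "even (k - (2 * m + 1 + j))" using j by (simp add: B_def)
      then have "k - j = 2 * m + 1 + 2 * l" using j by (auto simp: B_def l_def)
      then have "(- sin \<theta>) ^ (k - j) = - (sin \<theta> ^ (2 * m + 1)) * (sin \<theta>)\<^sup>2 ^ l"
        by (simp add: power_add flip: power_mult)
      then show "- (sin \<theta> ^ (2 * m + 1)) * poly (smult (c j) (W ^ ((k - (2 * m + 1 + j)) div 2) * monom 1 j)) (cos \<theta>)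
          = c j * (- sin \<theta>) ^ (k - j) * cos \<theta> ^ j"
        unfolding l_def[symmetric] by (simp add: poly_monom W_cos)
    qed
    moreover have "eval2 p (- sin \<theta>, cos \<theta>) = (\<Sum>j\<in>A \<union> B. c j * (- sin \<theta>) ^ (k - j) * cos \<theta> ^ j)"
      unfolding eval2_homogeneous2[OF p] fst_conv snd_conv c_def[symmetric]
    proof (intro sum.mono_neutral_right ballI)
      \<comment> \<open>The remaining exponents \<open>k - j\<close> of \<open>x1\<close> are odd
        and below \<open>2 * m + 1\<close>, where the conditions force the coefficient to be
        0.\<close>
      fix j assume j: "j \<in> {..k} - (A \<union> B)"
      have "odd (k - j)" "\<not> 2 * m + 1 + j \<le> k" using j by (auto simp: A_def B_def)
      then obtain l where l: "k - j = 2 * l + 1" "l < m" by (elim oddE) simp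
      then have "k - j = 2 * Suc l - 1" "Suc l \<in> {1..m}" by simp_all
      then have "c j = 0" using x1 unfolding c_def x1_quasi_invariant_def by metis
      then show "c j * (- sin \<theta>) ^ (k - j) * cos \<theta> ^ j = 0" by simp
    qed (auto simp: A_def B_def)
    moreover have "A \<inter> B = {}" "finite A" by (auto simp: A_def B_def)
    ultimately show ?thesis using \<open>finite B\<close> by (simp add: sum.union_disjoint)
  qed
  then have "eval2 (p - homogenize m k (a + b)) (- sin \<theta>, cos \<theta>) = 0" for \<theta>
    by (simp add: homogenize_add homogenize_even_circle[OF a] homogenize_odd_circle[OF b])
  moreover have "p - homogenize m k (a + b) \<in> homogeneous2 k"
    unfolding homogenize_add
    by (intro cpoly2.subspace_diff cpoly2.subspace_add homogeneous2_subspace p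
        homogenize_even_homogeneous2 homogenize_odd_homogeneous2 a b)
  ultimately have "p = homogenize m k (a + b)" using homogeneous2_eq_0 by fastforce
  then show ?thesis using that a b by blast
qed

text \<open>The derivative of \<open>sin\<^bsup>2m+1\<^esup> \<theta> b(cos \<theta>)\<close>, divided by \<open>sin\<^bsup>2m\<^esup> \<theta>\<close>, as a polynomial in \<open>cos \<theta>\<close>.\<close>

definition odd_derivative :: "nat \<Rightarrow> complex poly \<Rightarrow> complex poly" where
  "odd_derivative m b = smult (of_nat (2 * m + 1)) ([:0, 1:] * b) - [:1, 0, -1:] * pderiv b"

lemma poly_odd_derivative:
  "poly (odd_derivative m b) x = of_nat (2 * m + 1) * x * poly b x - (1 - x\<^sup>2) * poly (pderiv b) x"
  by (simp add: odd_derivative_def algebra_simps power2_eq_square)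

text \<open>By \<open>dir_deriv_circle\<close> this is minus the derivative in \<theta> of
  \<open>a(cos \<theta>) - sin^(2m+1) \<theta> b(cos \<theta>)\<close>.\<close>

lemma dir_deriv_homogenize:
  assumes a: "a \<in> even_profiles k" and b: "b \<in> odd_profiles m k"
  shows "eval2 (dir_deriv (cos \<theta>, sin \<theta>) (homogenize m k (a + b))) (- sin \<theta>, cos \<theta>)
       = sin \<theta> * poly (pderiv a) (cos \<theta>) + sin \<theta> ^ (2 * m) * poly (odd_derivative m b) (cos \<theta>)"
proof -
  let ?p = "homogenize m k (a + b)"
  have "((\<lambda>\<theta>. eval2 ?p (- sin \<theta>, cos \<theta>)) has_field_derivative
      - eval2 (dir_deriv (cos \<theta>, sin \<theta>) ?p) (- sin \<theta>, cos \<theta>)) (at \<theta>)"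
    by (rule dir_deriv_circle)
  moreover have "((\<lambda>\<theta>. poly a (cos \<theta>) - sin \<theta> ^ (2 * m + 1) * poly b (cos \<theta>)) has_field_derivative
      (- sin \<theta> * poly (pderiv a) (cos \<theta>) - ((of_nat (2 * m + 1) * sin \<theta> ^ (2 * m) * cos \<theta>) * poly b (cos \<theta>)
        + sin \<theta> ^ (2 * m + 1) * (- sin \<theta> * poly (pderiv b) (cos \<theta>))))) (at \<theta>)"
    by (rule derivative_eq_intros refl | simp)+
  moreover have "eval2 ?p (- sin \<theta>, cos \<theta>) = poly a (cos \<theta>) - sin \<theta> ^ (2 * m + 1) * poly b (cos \<theta>)" for \<theta>
    by (simp add: homogenize_add homogenize_even_circle[OF a] homogenize_odd_circle[OF b])
  ultimately have "eval2 (dir_deriv (cos \<theta>, sin \<theta>) ?p) (- sin \<theta>, cos \<theta>)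
    = sin \<theta> * poly (pderiv a) (cos \<theta>) + ((of_nat (2 * m + 1) * sin \<theta> ^ (2 * m) * cos \<theta>) * poly b (cos \<theta>)
        - sin \<theta> ^ (2 * m + 1) * (sin \<theta> * poly (pderiv b) (cos \<theta>)))"
    using DERIV_unique by (fastforce simp: algebra_simps)
  also have "\<dots> = sin \<theta> * poly (pderiv a) (cos \<theta>) + sin \<theta> ^ (2 * m) *
      (of_nat (2 * m + 1) * cos \<theta> * poly b (cos \<theta>) - (sin \<theta>)\<^sup>2 * poly (pderiv b) (cos \<theta>))"
    by (simp add: algebra_simps power2_eq_square)
  also have "\<dots> = sin \<theta> * poly (pderiv a) (cos \<theta>) + sin \<theta> ^ (2 * m) * poly (odd_derivative m b) (cos \<theta>)"
    by (simp add: poly_odd_derivative sin_squared_eq)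
  finally show ?thesis .
qed

section \<open>Gegenbauer polynomials\<close>

text \<open>Chebyshev polynomials of the first kind.\<close>

fun cheb :: "nat \<Rightarrow> 'a::comm_ring_1 poly" where
  "cheb 0 = 1"
| "cheb (Suc 0) = [:0, 1:]"
| "cheb (Suc (Suc k)) = [:0, 2:] * cheb (Suc k) - cheb k"

lemma poly_cheb_cos: "poly (cheb k) (cos \<theta>) = cos (of_nat k * \<theta> :: complex)"
proof (induction k rule: cheb.induct)
  case (3 k)
  have "cos (of_nat (Suc (Suc k)) * \<theta>) + cos (of_nat k * \<theta>) = 2 * cos (of_nat (Suc k) * \<theta>) * cos \<theta>"
    using cos_times_cos[of "of_nat (Suc k) * \<theta>" \<theta>] by (simp add: algebra_simps)
  then have "cos (of_nat (Suc (Suc k)) * \<theta>) = 2 * cos \<theta> * cos (of_nat (Suc k) * \<theta>) - cos (of_nat k * \<theta>)"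
    by (simp only: eq_diff_eq mult_ac)
  with 3 show ?case by (simp add: mult_ac)
qed simp_all

lemma has_parity_cheb: "has_parity k (cheb k :: 'a::idom poly)"
proof (induction k rule: cheb.induct)
  case (3 k)
  have "has_parity (1 + Suc k) ([:0, 2:] * cheb (Suc k) :: 'a poly)"
    using 3 by (intro has_parity_mult) (auto simp: has_parity_def coeff_pCons split: nat.splits)
  moreover have "has_parity (Suc (Suc k)) (cheb k :: 'a poly)"
    using 3 by (subst has_parity_cong[of "Suc (Suc k)" k]) simp_all
  ultimately show ?case by (auto intro!: has_parity_diff)
qed (auto simp: has_parity_def coeff_pCons coeff_1 split: nat.splits)

text \<open>For \<open>m \<ge> 1\<close> this is \<open>(m - 1)!\<close> times the coefficient of
  \<open>t^j\<close> in \<open>(1 - t)^(-m)\<close>. Products of two weights come from the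
  factorization \<open>1 - 2 t cos \<theta> + t^2 = (1 - t e^(i\<theta>)) (1 - t
  e^(-i\<theta>))\<close> in the generating function.\<close>

definition gegenbauer_weight :: "nat \<Rightarrow> nat \<Rightarrow> complex" where
  "gegenbauer_weight m j = fact (m + j - 1) / fact j"

definition gegenbauer_coeff :: "nat \<Rightarrow> nat \<Rightarrow> nat \<Rightarrow> complex" where
  "gegenbauer_coeff m n j = gegenbauer_weight m j * gegenbauer_weight m (n - j)"

text \<open>The polynomial \<open>C\<^sub>n\<^bsup>(m)\<^esup>\<close> up to the factor \<open>((m - 1)!)\<^sup>2\<close>, expanded in cosines.\<close>

definition gegenbauer :: "nat \<Rightarrow> nat \<Rightarrow> complex poly" where
  "gegenbauer m n = (\<Sum>j\<le>n. smult (gegenbauer_coeff m n j) (cheb (nat \<bar>int n - 2 * int j\<bar>)))"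

lemma gegenbauer_weight_Suc:
  assumes "m \<ge> 1"
  shows "of_nat (Suc j) * gegenbauer_weight m (Suc j) = of_nat (m + j) * gegenbauer_weight m j"
proof -
  have "fact (m + Suc j - 1) = of_nat (m + j) * (fact (m + j - 1) :: complex)"
    using assms by (cases m) simp_all
  moreover have "of_nat (Suc j) * (x / fact (Suc j)) = x / (fact j :: complex)" for x
    by (simp add: fact_Suc del: of_nat_Suc)
  ultimately show ?thesis by (simp add: gegenbauer_weight_def del: of_nat_Suc fact_Suc)
qed

text \<open>The ratio of consecutive coefficients, cleared of denominators; it makes the sum in
  \<open>gegenbauer_trig_identity\<close> telescope.\<close>

lemma gegenbauer_coeff_Suc:
  assumes "m \<ge> 1" "j < n"
  shows "of_nat (Suc j) * of_nat (n - Suc j + m) * gegenbauer_coeff m n (Suc j)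
       = of_nat (n - j) * of_nat (j + m) * gegenbauer_coeff m n j"
proof -
  let ?g = "gegenbauer_weight m"
  have n: "n - j = Suc (n - Suc j)" using assms by simp
  have "of_nat (Suc j) * of_nat (n - Suc j + m) * gegenbauer_coeff m n (Suc j)
      = (of_nat (Suc j) * ?g (Suc j)) * (of_nat (m + (n - Suc j)) * ?g (n - Suc j))"
    by (simp only: gegenbauer_coeff_def mult_ac add.commute)
  also have "\<dots> = (of_nat (m + j) * ?g j) * (of_nat (n - j) * ?g (n - j))"
    unfolding n gegenbauer_weight_Suc[OF assms(1)] ..
  finally show ?thesis by (simp only: gegenbauer_coeff_def mult_ac add.commute)
qed

lemma gegenbauer_coeff_sym: "j \<le> n \<Longrightarrow> gegenbauer_coeff m n (n - j) = gegenbauer_coeff m n j"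
  by (simp add: gegenbauer_coeff_def)

lemma has_parity_gegenbauer: "has_parity n (gegenbauer m n)"
  unfolding gegenbauer_def
proof (intro has_parity_sum has_parity_smult)
  fix j
  have "even (n + nat \<bar>int n - 2 * int j\<bar>)"
    by (simp add: even_nat_iff)
  then show "has_parity n (cheb (nat \<bar>int n - 2 * int j\<bar>) :: complex poly)"
    using has_parity_cheb has_parity_cong by metis
qed

text \<open>The frequency is signed, whereas the index of \<open>cheb\<close> is its absolute value;
  the cosine does not see the difference.\<close>

definition freq :: "nat \<Rightarrow> nat \<Rightarrow> complex" where
  "freq n j = of_nat n - 2 * of_nat j"

lemma poly_gegenbauer_cos:
  "poly (gegenbauer m n) (cos \<theta>) = (\<Sum>j\<le>n. gegenbauer_coeff m n j * cos (freq n j * \<theta>))"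
proof -
  have "cos (of_nat (nat \<bar>int n - 2 * int j\<bar>) * \<theta>) = cos (freq n j * \<theta>)" for j
  proof (cases "2 * j \<le> n")
    case True
    then have "nat \<bar>int n - 2 * int j\<bar> = n - 2 * j" by simp
    with True show ?thesis by (simp add: freq_def of_nat_diff)
  next
    case False
    then have "nat \<bar>int n - 2 * int j\<bar> = 2 * j - n" by simp
    with False have "of_nat (nat \<bar>int n - 2 * int j\<bar>) * \<theta> = - (freq n j * \<theta>)"
      by (simp add: freq_def of_nat_diff algebra_simps)
    then show ?thesis by simp
  qed
  then show ?thesis by (simp add: gegenbauer_def poly_sum poly_cheb_cos)
qed

text \<open>The reflection \<open>j\<close> to \<open>n - j\<close> keeps the coefficients and
  negates the frequencies, so the two exponential halves of the cosine sum agree.\<close>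

lemma poly_gegenbauer_cos_exp:
  "poly (gegenbauer m n) (cos \<theta>) = (\<Sum>j\<le>n. gegenbauer_coeff m n j * exp (\<i> * (freq n j * \<theta>)))"
proof -
  have "(\<Sum>j\<le>n. gegenbauer_coeff m n j * exp (- (\<i> * (freq n j * \<theta>))))
      = (\<Sum>j\<le>n. gegenbauer_coeff m n j * exp (\<i> * (freq n j * \<theta>)))"
    by (rule sum.reindex_bij_witness[of _ "\<lambda>j. n - j" "\<lambda>j. n - j"])
       (auto simp: gegenbauer_coeff_sym freq_def of_nat_diff algebra_simps)
  then show ?thesis unfolding poly_gegenbauer_cos
    by (simp add: cos_exp_eq distrib_left sum.distrib flip: sum_divide_distrib)
qed

text \<open>For \<open>f(\<theta>) = C(cos \<theta>)\<close> this is the differential equation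
  \<open>sin \<theta> (f'' + n (n + 2m) f) + 2m cos \<theta> f' = 0\<close>.\<close>

lemma gegenbauer_trig_identity:
  assumes "m \<ge> 1"
  shows "sin \<theta> * (\<Sum>j\<le>n. gegenbauer_coeff m n j * (of_nat n * of_nat (n + 2 * m) - (freq n j)\<^sup>2) * cos (freq n j * \<theta>))
       = 2 * of_nat m * cos \<theta> * (\<Sum>j\<le>n. gegenbauer_coeff m n j * freq n j * sin (freq n j * \<theta>))"
proof -
  \<comment> \<open>The product formulas turn the \<open>j\<close>-th term into sines of frequency
    \<open>freq n j + 1\<close> and \<open>freq n j - 1\<close>, and the latter equals
    \<open>freq n (Suc j) + 1\<close>. Both ends of the telescope vanish: at 0 by the factor
    \<open>j\<close>, beyond \<open>n\<close> by the default value.\<close>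
  define U where "U j = (if j \<le> n then of_nat j * of_nat (n - j + m) * gegenbauer_coeff m n j * sin ((freq n j + 1) * \<theta>) else 0)" for j
  have "sin \<theta> * (gegenbauer_coeff m n j * (of_nat n * of_nat (n + 2 * m) - (freq n j)\<^sup>2) * cos (freq n j * \<theta>))
      - 2 * of_nat m * cos \<theta> * (gegenbauer_coeff m n j * freq n j * sin (freq n j * \<theta>))
      = 2 * (U j - U (Suc j))" if "j \<le> n" for j
  proof -
    define c where "c = gegenbauer_coeff m n j"
    have sp: "sin ((freq n j + 1) * \<theta>) = sin (freq n j * \<theta>) * cos \<theta> + cos (freq n j * \<theta>) * sin \<theta>"
      by (simp add: distrib_right sin_add)
    have sm: "sin ((freq n j - 1) * \<theta>) = sin (freq n j * \<theta>) * cos \<theta> - cos (freq n j * \<theta>) * sin \<theta>"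
      by (simp add: left_diff_distrib sin_diff)
    have nj: "of_nat (n - j) = (of_nat n - of_nat j :: complex)" using that by (simp add: of_nat_diff)
    have "U (Suc j) = of_nat (n - j) * of_nat (j + m) * c * sin ((freq n j - 1) * \<theta>)"
    proof (cases "j = n")
      case True
      then show ?thesis by (simp add: U_def)
    next
      case False
      then have "j < n" using that by simp
      then have "U (Suc j) = of_nat (Suc j) * of_nat (n - Suc j + m) * gegenbauer_coeff m n (Suc j)
          * sin ((freq n (Suc j) + 1) * \<theta>)"
        by (simp only: U_def Suc_le_eq if_True)
      moreover have "freq n (Suc j) + 1 = freq n j - 1" by (simp add: freq_def)
      ultimately show ?thesis
        by (simp only: gegenbauer_coeff_Suc[OF assms \<open>j < n\<close>] c_def)
    qed
    moreover have "U j = of_nat j * of_nat (n - j + m) * c * sin ((freq n j + 1) * \<theta>)"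
      using that by (simp add: U_def c_def)
    moreover have "s * (c * (x * (x + 2 * y) - (x - 2 * z)\<^sup>2) * C) - 2 * y * t * (c * (x - 2 * z) * S)
        = 2 * (z * (x - z + y) * c * (S * t + C * s) - (x - z) * (z + y) * c * (S * t - C * s))"
      for s t S C x y z :: complex
      by (simp add: power2_eq_square algebra_simps)
    ultimately show ?thesis
      unfolding c_def[symmetric] sp sm by (simp add: nj freq_def)
  qed
  then have "(\<Sum>j\<le>n. sin \<theta> * (gegenbauer_coeff m n j * (of_nat n * of_nat (n + 2 * m) - (freq n j)\<^sup>2) * cos (freq n j * \<theta>))
      - 2 * of_nat m * cos \<theta> * (gegenbauer_coeff m n j * freq n j * sin (freq n j * \<theta>)))
      = (\<Sum>j\<le>n. 2 * (U j - U (Suc j)))"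
    by (intro sum.cong) auto
  also have "\<dots> = 2 * (U 0 - U (Suc n))"
    by (simp only: sum_distrib_left[symmetric] sum_telescope)
  also have "\<dots> = 0" by (simp add: U_def)
  finally show ?thesis by (simp add: sum_subtractf sum_distrib_left)
qed

text \<open>The trigonometric identity carried over to \<open>x = cos \<theta>\<close> by
  differentiating \<open>C(cos \<theta>)\<close> twice; a common factor \<open>sin \<theta>\<close>
  cancels.\<close>

lemma gegenbauer_ode:
  assumes "m \<ge> 1"
  shows "smult (of_nat n * of_nat (n + 2 * m)) (gegenbauer m n)
    + [:1, 0, -1:] * pderiv (pderiv (gegenbauer m n))
    - smult (of_nat (2 * m + 1)) ([:0, 1:] * pderiv (gegenbauer m n)) = 0" (is "?D = 0")
proof (rule poly_cos_sin_eq_0)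
  fix \<theta> :: complex assume "sin \<theta> \<noteq> 0"
  let ?C = "gegenbauer m n" and ?c = "gegenbauer_coeff m n" and ?\<nu> = "freq n"
  have D1: "sin t * poly (pderiv ?C) (cos t) = (\<Sum>j\<le>n. ?c j * ?\<nu> j * sin (?\<nu> j * t))" for t
  proof -
    have "((\<lambda>t. poly ?C (cos t)) has_field_derivative - sin t * poly (pderiv ?C) (cos t)) (at t)"
      by (rule derivative_eq_intros refl | simp)+
    moreover have "((\<lambda>t. \<Sum>j\<le>n. ?c j * cos (?\<nu> j * t)) has_field_derivative
        (\<Sum>j\<le>n. - (?c j * ?\<nu> j * sin (?\<nu> j * t)))) (at t)"
      by (intro DERIV_sum) (rule derivative_eq_intros refl | simp)+
    ultimately have "- sin t * poly (pderiv ?C) (cos t) = (\<Sum>j\<le>n. - (?c j * ?\<nu> j * sin (?\<nu> j * t)))"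
      unfolding poly_gegenbauer_cos by (rule DERIV_unique)
    then show ?thesis by (simp add: sum_negf)
  qed
  have "((\<lambda>t. sin t * poly (pderiv ?C) (cos t)) has_field_derivative
      cos \<theta> * poly (pderiv ?C) (cos \<theta>) - (sin \<theta>)\<^sup>2 * poly (pderiv (pderiv ?C)) (cos \<theta>)) (at \<theta>)"
    by (rule derivative_eq_intros refl | simp add: power2_eq_square)+
  moreover have "((\<lambda>t. \<Sum>j\<le>n. ?c j * ?\<nu> j * sin (?\<nu> j * t)) has_field_derivative
      (\<Sum>j\<le>n. ?c j * (?\<nu> j)\<^sup>2 * cos (?\<nu> j * \<theta>))) (at \<theta>)"
    by (intro DERIV_sum) (rule derivative_eq_intros refl | simp add: power2_eq_square)+
  ultimately have D2: "cos \<theta> * poly (pderiv ?C) (cos \<theta>) - (sin \<theta>)\<^sup>2 * poly (pderiv (pderiv ?C)) (cos \<theta>)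
      = (\<Sum>j\<le>n. ?c j * (?\<nu> j)\<^sup>2 * cos (?\<nu> j * \<theta>))"
    unfolding D1 by (rule DERIV_unique)
  have sum: "(\<Sum>j\<le>n. ?c j * (of_nat n * of_nat (n + 2 * m) - (?\<nu> j)\<^sup>2) * cos (?\<nu> j * \<theta>))
      = of_nat n * of_nat (n + 2 * m) * poly ?C (cos \<theta>)
        - (cos \<theta> * poly (pderiv ?C) (cos \<theta>) - (sin \<theta>)\<^sup>2 * poly (pderiv (pderiv ?C)) (cos \<theta>))"
    unfolding D2 poly_gegenbauer_cos sum_distrib_left sum_subtractf[symmetric]
    by (intro sum.cong) (simp_all add: algebra_simps)
  have "sin \<theta> * (of_nat n * of_nat (n + 2 * m) * poly ?C (cos \<theta>)
        - (cos \<theta> * poly (pderiv ?C) (cos \<theta>) - (sin \<theta>)\<^sup>2 * poly (pderiv (pderiv ?C)) (cos \<theta>)))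
      = 2 * of_nat m * cos \<theta> * (sin \<theta> * poly (pderiv ?C) (cos \<theta>))"
    using gegenbauer_trig_identity[OF assms, of \<theta> n] unfolding sum D1[symmetric] .
  moreover have "poly ?D (cos \<theta>) = of_nat n * of_nat (n + 2 * m) * poly ?C (cos \<theta>)
      + (sin \<theta>)\<^sup>2 * poly (pderiv (pderiv ?C)) (cos \<theta>) - of_nat (2 * m + 1) * (cos \<theta> * poly (pderiv ?C) (cos \<theta>))"
    unfolding sin_squared_eq by (simp add: power2_eq_square algebra_simps)
  ultimately have "sin \<theta> * poly ?D (cos \<theta>) = 0"
    by (simp only:) (simp add: algebra_simps)
  with \<open>sin \<theta> \<noteq> 0\<close> show "poly ?D (cos \<theta>) = 0" by simp
qed

text \<open>The leading coefficient of the differential equation forces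
  \<open>d (d + 2m) = n (n + 2m)\<close> for the degree \<open>d\<close>, and this expression is
  strictly increasing in \<open>d\<close>.\<close>

lemma degree_gegenbauer:
  assumes "m \<ge> 1" and nz: "gegenbauer m n \<noteq> 0"
  shows "degree (gegenbauer m n) = n"
proof -
  let ?C = "gegenbauer m n"
  define d where "d = degree ?C"
  define c where "c = coeff ?C d"
  have "c \<noteq> 0" using nz by (simp add: c_def d_def)
  have "coeff (pderiv (pderiv ?C)) d = 0"
    by (simp add: coeff_pderiv coeff_eq_0 d_def)
  \<comment> \<open>Only the term \<open>- x^2\<close> of the factor contributes at
    \<open>d\<close>; \<open>cheb.cases\<close> merely supplies the case split into 0, 1 and
    \<open>Suc (Suc k)\<close>.\<close>
  then have 1: "coeff ([:1, 0, -1:] * pderiv (pderiv ?C)) d = - (of_nat d * (of_nat d - 1) * c)"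
    unfolding c_def by (cases d rule: cheb.cases) (auto simp: coeff_pderiv coeff_pCons algebra_simps)
  have 2: "coeff ([:0, 1:] * pderiv ?C) d = of_nat d * c"
    unfolding c_def by (cases d) (auto simp: coeff_pderiv)
  have "coeff (smult (of_nat n * of_nat (n + 2 * m)) ?C + [:1, 0, -1:] * pderiv (pderiv ?C)
      - smult (of_nat (2 * m + 1)) ([:0, 1:] * pderiv ?C)) d = 0"
    unfolding gegenbauer_ode[OF assms(1)] by simp
  then have "(of_nat n * of_nat (n + 2 * m) - of_nat d * of_nat (d + 2 * m)) * c = 0"
    unfolding coeff_diff coeff_add coeff_smult 1 2 c_def[symmetric] by (simp add: algebra_simps)
  with \<open>c \<noteq> 0\<close> have "of_nat (n * (n + 2 * m)) = (of_nat (d * (d + 2 * m)) :: complex)" by simp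
  then have eq: "n * (n + 2 * m) = d * (d + 2 * m)" unfolding of_nat_eq_iff .
  have "x * (x + 2 * m) < y * (y + 2 * m)" if "x < y" for x y
    using that by (intro mult_strict_mono) auto
  with eq show ?thesis unfolding d_def[symmetric] by (metis nat_neq_iff)
qed

section \<open>The configuration\<close>

text \<open>Vieta's formula: the expansion over subsets, grouped by cardinality.\<close>

lemma prod_diff_eq_esym:
  fixes z :: "'i \<Rightarrow> 'a::comm_ring_1"
  assumes "finite I"
  shows "(\<Prod>i\<in>I. x - z i) = (\<Sum>k\<le>card I. (-1) ^ k * esym I k z * x ^ (card I - k))"
proof -
  have "(\<Prod>i\<in>I. x - z i) = (\<Sum>X\<in>Pow I. (-1) ^ card X * (\<Prod>i\<in>X. z i) * x ^ (card I - card X))"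
    unfolding prod_diff_conv_sum[OF assms]
    by (intro sum.cong) (auto simp: card_Diff_subset assms finite_subset)
  also have "\<dots> = (\<Sum>k\<le>card I. \<Sum>X | X \<in> Pow I \<and> card X = k. (-1) ^ card X * (\<Prod>i\<in>X. z i) * x ^ (card I - card X))"
    using assms by (intro sum.group[symmetric]) (auto intro: card_mono)
  also have "\<dots> = (\<Sum>k\<le>card I. (-1) ^ k * esym I k z * x ^ (card I - k))"
    by (intro sum.cong) (auto simp: esym_def sum_distrib_left sum_distrib_right)
  finally show ?thesis .
qed

definition config_node :: "(nat \<Rightarrow> real) \<Rightarrow> nat \<Rightarrow> complex" where
  "config_node \<phi> s = exp (2 * \<i> * complex_of_real (\<phi> s))"

text \<open>The square of \<open>exp (\<i> * \<theta>)\<close> determines it up to sign, hence also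
  the pair of cosine and sine. Here \<theta> may be complex.\<close>

lemma unit_vec_eq_or_minus:
  assumes "config_node \<phi> s = exp (2 * \<i> * \<theta>)"
  shows "(cos \<theta> = cos (complex_of_real (\<phi> s)) \<and> sin \<theta> = sin (complex_of_real (\<phi> s)))
    \<or> (cos \<theta> = - cos (complex_of_real (\<phi> s)) \<and> sin \<theta> = - sin (complex_of_real (\<phi> s)))"
proof -
  define w v where "w = exp (\<i> * \<theta>)" and "v = exp (\<i> * complex_of_real (\<phi> s))"
  have "v\<^sup>2 = w\<^sup>2"
    using assms by (simp add: config_node_def w_def v_def mult.assoc flip: exp_double)
  then have "w = v \<or> w = - v" by (auto simp: power2_eq_iff)
  then show ?thesis
    by (auto simp: cos_exp_eq sin_exp_eq exp_minus w_def[symmetric] v_def[symmetric] field_simps)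
qed

text \<open>Pairwise non-collinearity enters here: equal nodes would make the unit vectors equal up
  to sign.\<close>

lemma config_node_inj:
  assumes "config_angles m n \<phi>" "s \<le> n" "r \<le> n" "s \<noteq> r"
  shows "config_node \<phi> s \<noteq> config_node \<phi> r"
proof
  assume eq: "config_node \<phi> s = config_node \<phi> r"
  have "unit_vec (\<phi> r) = unit_vec (\<phi> s) \<or> unit_vec (\<phi> r) = - unit_vec (\<phi> s)"
    using unit_vec_eq_or_minus[of \<phi> s "complex_of_real (\<phi> r)"] eq
    by (auto simp: config_node_def[of \<phi> r] unit_vec_def cos_of_real sin_of_real
        simp flip: of_real_minus)
  then have "unit_vec (\<phi> r) = 1 *\<^sub>R unit_vec (\<phi> s) \<or> unit_vec (\<phi> r) = (- 1) *\<^sub>R unit_vec (\<phi> s)"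
    by simp
  then have "collinear {0, unit_vec (\<phi> s), unit_vec (\<phi> r)}"
    unfolding collinear_lemma by blast
  with assms show False unfolding config_angles_def by blast
qed

lemma config_node_0:
  assumes "config_angles m n \<phi>"
  shows "config_node \<phi> 0 = 1"
proof -
  have "exp (\<i> * complex_of_real (\<phi> 0)) = 1"
    using assms by (simp add: config_angles_def unit_vec_def exp_Euler cos_of_real sin_of_real)
  then show ?thesis by (simp add: config_node_def exp_double mult.assoc)
qed

text \<open>Written in factorials, the prescribed values of the elementary symmetric polynomials
  are, up to sign and the constant \<open>K\<close>, the numbers
  \<open>gegenbauer_coeff m n k\<close>.\<close>

lemma prod_config_node:
  assumes "m \<ge> 1" and \<phi>: "config_angles m n \<phi>"
  obtains K where "K \<noteq> 0"
    "\<And>\<theta>. (\<Prod>i\<in>{1..n}. exp (2 * \<i> * \<theta>) - config_node \<phi> i)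
        = K * exp (\<i> * of_nat n * \<theta>) * poly (gegenbauer m n) (cos \<theta>)"
proof -
  define K :: complex where "K = fact n / (fact (m - 1) * fact (m + n - 1))"
  have esym: "(-1) ^ k * esym {1..n} k (config_node \<phi>) = K * gegenbauer_coeff m n k" if "k \<le> n" for k
  proof -
    have "esym {1..n} k (config_node \<phi>) = (-1) ^ k * of_nat (n choose k) * of_nat ((m + k - 1) choose k)
          * inverse (of_nat ((m + n - 1) choose k))"
    \<comment> \<open>The configuration prescribes the values for \<open>k \<ge> 1\<close> only; for
      \<open>k = 0\<close> both sides are 1.\<close>
    proof (cases "k = 0")
      case True
      have "{X. X \<subseteq> {1..n} \<and> card X = 0} = {{}}" by (auto dest: finite_subset[OF _ finite_atLeastAtMost])
      with True show ?thesis by (simp add: esym_def)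
    next
      case False
      have eq: "config_node \<phi> = (\<lambda>s. exp (2 * \<i> * complex_of_real (\<phi> s)))"
        by (simp add: fun_eq_iff config_node_def)
      show ?thesis using \<phi>[unfolded config_angles_def] False that unfolding eq by simp
    qed
    moreover have "of_nat (n choose k) = (fact n / (fact k * fact (n - k)) :: complex)"
      using that by (rule binomial_fact)
    moreover have "of_nat ((m + k - 1) choose k) = (fact (m + k - 1) / (fact k * fact (m - 1)) :: complex)"
      using binomial_fact[of k "m + k - 1", where 'a = complex] assms(1) by simp
    moreover have "of_nat ((m + n - 1) choose k) = (fact (m + n - 1) / (fact k * fact (m + (n - k) - 1)) :: complex)"
      using binomial_fact[of k "m + n - 1", where 'a = complex] assms(1) that by simp
    ultimately show ?thesis
      by (simp add: gegenbauer_coeff_def gegenbauer_weight_def K_def flip: power_mult_distrib)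
  qed
  have "(\<Prod>i\<in>{1..n}. exp (2 * \<i> * \<theta>) - config_node \<phi> i)
        = K * exp (\<i> * of_nat n * \<theta>) * poly (gegenbauer m n) (cos \<theta>)" for \<theta>
  proof -
    have "(\<Prod>i\<in>{1..n}. exp (2 * \<i> * \<theta>) - config_node \<phi> i)
        = (\<Sum>k\<le>n. K * gegenbauer_coeff m n k * exp (2 * \<i> * \<theta>) ^ (n - k))"
      by (subst prod_diff_eq_esym) (auto simp: esym[unfolded One_nat_def] intro!: sum.cong)
    also have "\<dots> = (\<Sum>k\<le>n. K * exp (\<i> * of_nat n * \<theta>) * (gegenbauer_coeff m n k * exp (\<i> * (freq n k * \<theta>))))"
    proof (intro sum.cong refl)
      fix k assume "k \<in> {..n}"
      then have "of_nat (n - k) * (2 * \<i> * \<theta>) = \<i> * of_nat n * \<theta> + \<i> * (freq n k * \<theta>)"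
        by (simp add: freq_def of_nat_diff algebra_simps)
      then have "exp (2 * \<i> * \<theta>) ^ (n - k) = exp (\<i> * of_nat n * \<theta>) * exp (\<i> * (freq n k * \<theta>))"
        by (metis exp_add exp_of_nat_mult)
      then show "K * gegenbauer_coeff m n k * exp (2 * \<i> * \<theta>) ^ (n - k)
        = K * exp (\<i> * of_nat n * \<theta>) * (gegenbauer_coeff m n k * exp (\<i> * (freq n k * \<theta>)))"
        by simp
    qed
    finally show ?thesis by (simp add: poly_gegenbauer_cos_exp sum_distrib_left)
  qed
  moreover have "K \<noteq> 0" by (simp add: K_def)
  ultimately show ?thesis using that by blast
qed

text \<open>Since the left side depends on \<open>cos \<theta>\<close> alone, this also shows that
  the set of nodes is closed under inversion.\<close>

lemma gegenbauer_root_iff: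
  assumes "m \<ge> 1" "config_angles m n \<phi>"
  shows "poly (gegenbauer m n) (cos \<theta>) = 0 \<longleftrightarrow> (\<exists>i\<in>{1..n}. config_node \<phi> i = exp (2 * \<i> * \<theta>))"
proof -
  obtain K where K: "K \<noteq> 0" "(\<Prod>i\<in>{1..n}. exp (2 * \<i> * \<theta>) - config_node \<phi> i)
        = K * exp (\<i> * of_nat n * \<theta>) * poly (gegenbauer m n) (cos \<theta>)"
    using prod_config_node[OF assms] by metis
  then have "poly (gegenbauer m n) (cos \<theta>) = 0 \<longleftrightarrow> (\<Prod>i\<in>{1..n}. exp (2 * \<i> * \<theta>) - config_node \<phi> i) = 0"
    by simp
  also have "\<dots> \<longleftrightarrow> (\<exists>i\<in>{1..n}. config_node \<phi> i = exp (2 * \<i> * \<theta>))"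
    by (simp add: eq_commute[of _ "exp (2 * \<i> * \<theta>)"])
  finally show ?thesis .
qed

text \<open>If the sine vanished, \<open>exp (2 * \<i> * \<theta>)\<close> would be 1, the node of
  index 0, which differs from the nodes of index 1 to \<open>n\<close>.\<close>

lemma gegenbauer_root_sin:
  assumes "m \<ge> 1" "config_angles m n \<phi>" "poly (gegenbauer m n) (cos \<theta>) = 0"
  shows "sin \<theta> \<noteq> 0"
proof
  assume "sin \<theta> = 0"
  obtain i where i: "i \<in> {1..n}" "config_node \<phi> i = exp (2 * \<i> * \<theta>)"
    using gegenbauer_root_iff[OF assms(1,2)] assms(3) by blast
  have "(exp (\<i> * \<theta>))\<^sup>2 = 1"
    using \<open>sin \<theta> = 0\<close> sin_cos_squared_add[of \<theta>] by (simp add: exp_Euler)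
  then have "exp (2 * \<i> * \<theta>) = 1" by (simp add: exp_double mult.assoc)
  then have "config_node \<phi> i = config_node \<phi> 0" using i config_node_0[OF assms(2)] by simp
  with config_node_inj[OF assms(2), of i 0] i show False by simp
qed

text \<open>As a function of \<theta>, the product over the nodes has only simple zeros because the
  nodes are distinct. A multiple root would make its derivative vanish too.\<close>

lemma rsquarefree_gegenbauer:
  assumes "m \<ge> 1" "config_angles m n \<phi>"
  shows "rsquarefree (gegenbauer m n)"
  unfolding rsquarefree_roots
proof (intro allI notI)
  fix x assume x: "poly (gegenbauer m n) x = 0 \<and> poly (pderiv (gegenbauer m n)) x = 0"
  define \<theta> where "\<theta> = Arccos x"
  have cos: "x = cos \<theta>" by (simp add: \<theta>_def)
  obtain i where i: "i \<in> {1..n}" "config_node \<phi> i = exp (2 * \<i> * \<theta>)"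
    using gegenbauer_root_iff[OF assms] x cos by blast
  obtain K where K: "\<And>\<theta>. (\<Prod>i\<in>{1..n}. exp (2 * \<i> * \<theta>) - config_node \<phi> i)
        = K * exp (\<i> * of_nat n * \<theta>) * poly (gegenbauer m n) (cos \<theta>)"
    using prod_config_node[OF assms] by metis
  define P where "P = (\<Prod>j\<in>{1..n} - {i}. [:- config_node \<phi> j, 1:])"
  have "(\<Prod>i\<in>{1..n}. exp (2 * \<i> * t) - config_node \<phi> i)
      = (exp (2 * \<i> * t) - config_node \<phi> i) * poly P (exp (2 * \<i> * t))" for t
    using i(1) by (simp add: prod.remove[of _ i] P_def poly_prod)
  then have F: "(exp (2 * \<i> * t) - config_node \<phi> i) * poly P (exp (2 * \<i> * t))
      = K * exp (\<i> * of_nat n * t) * poly (gegenbauer m n) (cos t)" for t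
    using K by metis
  have "((\<lambda>t. (exp (2 * \<i> * t) - config_node \<phi> i) * poly P (exp (2 * \<i> * t))) has_field_derivative
      2 * \<i> * exp (2 * \<i> * \<theta>) * poly P (exp (2 * \<i> * \<theta>))) (at \<theta>)"
    by (rule derivative_eq_intros refl | simp add: i(2))+
  moreover have "((\<lambda>t. K * exp (\<i> * of_nat n * t) * poly (gegenbauer m n) (cos t)) has_field_derivative 0) (at \<theta>)"
    using x unfolding cos by (auto intro!: derivative_eq_intros)
  ultimately have "2 * \<i> * exp (2 * \<i> * \<theta>) * poly P (exp (2 * \<i> * \<theta>)) = 0"
    unfolding F by (rule DERIV_unique)
  then have "poly P (config_node \<phi> i) = 0" using i(2) by simp
  then have "\<exists>j\<in>{1..n} - {i}. config_node \<phi> i = config_node \<phi> j"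
    by (auto simp: P_def poly_prod)
  then obtain j where "j \<in> {1..n}" "j \<noteq> i" "config_node \<phi> i = config_node \<phi> j" by blast
  with config_node_inj[OF assms(2), of i j] i(1) show False by simp
qed

lemma degree_gegenbauer_config:
  assumes "m \<ge> 1" "config_angles m n \<phi>"
  shows "degree (gegenbauer m n) = n"
  using degree_gegenbauer[OF assms(1)] rsquarefree_gegenbauer[OF assms] by (simp add: rsquarefree_def)

lemma gegenbauer_pderiv2_root:
  assumes "m \<ge> 1" "poly (gegenbauer m n) x = 0"
  shows "(1 - x\<^sup>2) * poly (pderiv (pderiv (gegenbauer m n))) x = of_nat (2 * m + 1) * x * poly (pderiv (gegenbauer m n)) x"
proof -
  have "poly (smult (of_nat n * of_nat (n + 2 * m)) (gegenbauer m n)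
    + [:1, 0, -1:] * pderiv (pderiv (gegenbauer m n))
    - smult (of_nat (2 * m + 1)) ([:0, 1:] * pderiv (gegenbauer m n))) x = 0"
    unfolding gegenbauer_ode[OF assms(1)] by simp
  with assms(2) show ?thesis by (simp add: algebra_simps power2_eq_square)
qed

text \<open>At a root of \<open>C\<close> the differential equation replaces
  \<open>(2m+1) x C'\<close> by \<open>(1 - x^2) C''\<close>, so \<open>C'\<close> times
  \<open>odd_derivative m b\<close> becomes \<open>(1 - x^2) (b C'' - b' C')\<close>. Neither
  \<open>C'\<close> nor \<open>1 - x^2\<close> vanishes there.\<close>

lemma gegenbauer_dvd_odd_derivative_iff:
  assumes "m \<ge> 1" "config_angles m n \<phi>"
  shows "gegenbauer m n dvd odd_derivative m b \<longleftrightarrow>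
    (\<forall>x. poly (gegenbauer m n) x = 0 \<longrightarrow>
      poly (pderiv b * pderiv (gegenbauer m n)) x = poly (b * pderiv (pderiv (gegenbauer m n))) x)"
proof -
  let ?C = "gegenbauer m n"
  have "poly (odd_derivative m b) x = 0 \<longleftrightarrow> poly (pderiv b * pderiv ?C) x = poly (b * pderiv (pderiv ?C)) x"
    if x: "poly ?C x = 0" for x
  proof -
    have "poly (pderiv ?C) x \<noteq> 0" using x rsquarefree_gegenbauer[OF assms] by (auto simp: rsquarefree_roots)
    moreover have "1 - x\<^sup>2 \<noteq> 0"
      using gegenbauer_root_sin[OF assms, of "Arccos x"] x sin_squared_eq[of "Arccos x"] by auto
    moreover have "poly (pderiv ?C) x * poly (odd_derivative m b) x
        = (1 - x\<^sup>2) * (poly (b * pderiv (pderiv ?C)) x - poly (pderiv b * pderiv ?C) x)"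
    proof -
      have "poly (pderiv ?C) x * poly (odd_derivative m b) x
        = of_nat (2 * m + 1) * x * poly (pderiv ?C) x * poly b x - (1 - x\<^sup>2) * poly (pderiv b * pderiv ?C) x"
        by (simp add: poly_odd_derivative algebra_simps)
      also have "\<dots> = (1 - x\<^sup>2) * (poly (b * pderiv (pderiv ?C)) x - poly (pderiv b * pderiv ?C) x)"
        unfolding gegenbauer_pderiv2_root[OF assms(1) x, symmetric] by (simp add: algebra_simps)
      finally show ?thesis .
    qed
    ultimately show ?thesis by (metis eq_iff_diff_eq_0 mult_eq_0_iff)
  qed
  then show ?thesis
    unfolding rsquarefree_dvd_iff[OF rsquarefree_gegenbauer[OF assms]] by blast
qed

section \<open>The two divisibility conditions\<close>

lemma dir_deriv_vanishes_on_line_iff: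
  assumes p: "p \<in> homogeneous2 k"
  shows "(\<forall>x. bil (cos \<theta>, sin \<theta>) x = 0 \<longrightarrow> eval2 (dir_deriv (cos \<theta>, sin \<theta>) p) x = 0) \<longleftrightarrow>
    eval2 (dir_deriv (cos \<theta>, sin \<theta>) p) (- sin \<theta>, cos \<theta>) = 0" (is "?L \<longleftrightarrow> ?R")
proof
  assume ?L
  then show ?R by (simp add: bil_def)
next
  assume R: ?R
  show ?L
  proof (intro allI impI)
    fix x assume "bil (cos \<theta>, sin \<theta>) x = 0"
    then have x: "cos \<theta> * fst x + sin \<theta> * snd x = 0" by (simp add: bil_def)
    \<comment> \<open>The coordinate of \<open>x\<close> along the line: \<open>x\<close> is
      \<open>t\<close> times \<open>(- sin \<theta>, cos \<theta>)\<close>, and the derivative of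
      \<open>p\<close> is homogeneous.\<close>
    define t where "t = cos \<theta> * snd x - sin \<theta> * fst x"
    have "(c * v - s * u) * - s = (s\<^sup>2 + c\<^sup>2) * u - c * (c * u + s * v)"
      "(c * v - s * u) * c = (s\<^sup>2 + c\<^sup>2) * v - s * (c * u + s * v)" for c s u v :: complex
      by (simp_all add: power2_eq_square algebra_simps)
    then have "t * - sin \<theta> = ((sin \<theta>)\<^sup>2 + (cos \<theta>)\<^sup>2) * fst x - cos \<theta> * (cos \<theta> * fst x + sin \<theta> * snd x)"
      and "t * cos \<theta> = ((sin \<theta>)\<^sup>2 + (cos \<theta>)\<^sup>2) * snd x - sin \<theta> * (cos \<theta> * fst x + sin \<theta> * snd x)"
      unfolding t_def by blast+
    then have "x = (t * - sin \<theta>, t * cos \<theta>)" unfolding x by (simp add: prod_eq_iff)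
    then have "eval2 (dir_deriv (cos \<theta>, sin \<theta>) p) x
        = t ^ (k - 1) * eval2 (dir_deriv (cos \<theta>, sin \<theta>) p) (- sin \<theta>, cos \<theta>)"
      by (simp only: eval2_homogeneous2_scale[OF dir_deriv_homogeneous2[OF p]])
    with R show "eval2 (dir_deriv (cos \<theta>, sin \<theta>) p) x = 0" by simp
  qed
qed

lemma Q_config_iff:
  assumes \<phi>: "config_angles m n \<phi>" and p: "p \<in> homogeneous2 k"
  shows "p \<in> Q_config m n \<phi> \<longleftrightarrow> x1_quasi_invariant m p \<and> (\<forall>i\<in>{1..n}.
    eval2 (dir_deriv (cos (complex_of_real (\<phi> i)), sin (complex_of_real (\<phi> i))) p)
      (- sin (complex_of_real (\<phi> i)), cos (complex_of_real (\<phi> i))) = 0)"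
proof -
  define V where "V i \<longleftrightarrow> (\<forall>s\<in>{1..config_mult m i}. \<forall>x. bil (complexify (unit_vec (\<phi> i))) x = 0 \<longrightarrow>
           eval2 ((dir_deriv (complexify (unit_vec (\<phi> i))) ^^ (2 * s - 1)) p) x = 0)" for i
  have "p \<in> Q_config m n \<phi> \<longleftrightarrow> (\<forall>i\<in>{0..n}. V i)"
    by (simp add: Q_config_def quasi_invariants_def V_def)
  also have "{0..n} = insert 0 {1..n}" by auto
  finally have "p \<in> Q_config m n \<phi> \<longleftrightarrow> V 0 \<and> (\<forall>i\<in>{1..n}. V i)" by simp
  moreover have "V 0 \<longleftrightarrow> x1_quasi_invariant m p"
  proof -
    have "complexify (unit_vec (\<phi> 0)) = (1, 0)"
      using \<phi> by (simp add: config_angles_def complexify_def)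
    then show ?thesis
      by (simp only: V_def dir_deriv_x1_power_vanishes_iff x1_quasi_invariant_def config_mult_def if_True simp_thms)
  qed
  moreover have "V i \<longleftrightarrow> eval2 (dir_deriv (cos (complex_of_real (\<phi> i)), sin (complex_of_real (\<phi> i))) p)
      (- sin (complex_of_real (\<phi> i)), cos (complex_of_real (\<phi> i))) = 0" if "i \<in> {1..n}" for i
  proof -
    have \<alpha>: "complexify (unit_vec (\<phi> i)) = (cos (complex_of_real (\<phi> i)), sin (complex_of_real (\<phi> i)))"
      by (simp add: complexify_def unit_vec_def cos_of_real sin_of_real)
    have 1: "config_mult m i = 1" using that by (simp add: config_mult_def)
    have "V i \<longleftrightarrow> (\<forall>x. bil (complexify (unit_vec (\<phi> i))) x = 0 \<longrightarrow>
        eval2 (dir_deriv (complexify (unit_vec (\<phi> i))) p) x = 0)"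
      unfolding V_def 1 by simp
    then show ?thesis unfolding \<alpha> dir_deriv_vanishes_on_line_iff[OF p] .
  qed
  ultimately show ?thesis by simp
qed

text \<open>The derivative conditions hold at all angles over the roots of \<open>C\<close>, a set
  stable under negation of the angle; this symmetry separates the conditions on \<open>a\<close> and
  \<open>b\<close>.\<close>

lemma homogenize_config_iff:
  assumes "m \<ge> 1" "config_angles m n \<phi>" and a: "a \<in> even_profiles k" and b: "b \<in> odd_profiles m k"
  shows "homogenize m k (a + b) \<in> Q_config m n \<phi> \<longleftrightarrow>
    gegenbauer m n dvd pderiv a \<and> gegenbauer m n dvd odd_derivative m b"
proof -
  let ?C = "gegenbauer m n"
  define p where "p = homogenize m k (a + b)"
  define g where "g \<theta> = eval2 (dir_deriv (cos \<theta>, sin \<theta>) p) (- sin \<theta>, cos \<theta>)" for \<theta>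
  have g: "g \<theta> = sin \<theta> * poly (pderiv a) (cos \<theta>) + sin \<theta> ^ (2 * m) * poly (odd_derivative m b) (cos \<theta>)" for \<theta>
    unfolding g_def p_def by (rule dir_deriv_homogenize[OF a b])
  have p: "p \<in> homogeneous2 k"
    unfolding p_def homogenize_add by (intro cpoly2.subspace_add homogeneous2_subspace
        homogenize_even_homogeneous2 homogenize_odd_homogeneous2 a b)
  \<comment> \<open>A node determines the angle only modulo \<pi>; a shift by \<pi> negates both the
    vector and the point, and homogeneity preserves the zero.\<close>
  have g_eq_0: "g \<theta> = 0"
    if "config_node \<phi> i = exp (2 * \<i> * \<theta>)" "g (complex_of_real (\<phi> i)) = 0" for \<theta> i
    using unit_vec_eq_or_minus[OF that(1)]
  proof (elim disjE conjE)
    assume "cos \<theta> = cos (complex_of_real (\<phi> i))" "sin \<theta> = sin (complex_of_real (\<phi> i))"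
    with that(2) show ?thesis by (simp add: g_def)
  next
    define c s where "c = cos (complex_of_real (\<phi> i))" and "s = sin (complex_of_real (\<phi> i))"
    assume "cos \<theta> = - cos (complex_of_real (\<phi> i))" "sin \<theta> = - sin (complex_of_real (\<phi> i))"
    then have "cos \<theta> = - 1 * c" "sin \<theta> = - 1 * s" by (simp_all add: c_def s_def)
    moreover have "eval2 (dir_deriv (- 1 * c, - 1 * s) p) (- 1 * - s, - 1 * c) = 0"
      using that(2) unfolding dir_deriv_scale eval2_simps
        eval2_homogeneous2_scale[OF dir_deriv_homogeneous2[OF p]]
      by (simp add: g_def c_def s_def)
    ultimately show ?thesis unfolding g_def by simp
  qed
  have x1: "x1_quasi_invariant m p" unfolding p_def by (rule homogenize_x1_quasi_invariant)
  have "p \<in> Q_config m n \<phi> \<longleftrightarrow> (\<forall>i\<in>{1..n}. g (complex_of_real (\<phi> i)) = 0)"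
    using x1 unfolding Q_config_iff[OF assms(2) p] g_def by blast
  also have "\<dots> \<longleftrightarrow> ?C dvd pderiv a \<and> ?C dvd odd_derivative m b"
  proof
    assume L: "\<forall>i\<in>{1..n}. g (complex_of_real (\<phi> i)) = 0"
    have "poly (pderiv a) x = 0 \<and> poly (odd_derivative m b) x = 0" if x: "poly ?C x = 0" for x
    proof -
      define \<theta> where "\<theta> = Arccos x"
      have cos: "cos \<theta> = x" "cos (- \<theta>) = x" by (simp_all add: \<theta>_def)
      have "g t = 0" if t: "cos t = x" for t
      proof -
        have "poly ?C (cos t) = 0" using x t by simp
        then obtain i where "i \<in> {1..n}" "config_node \<phi> i = exp (2 * \<i> * t)"
          unfolding gegenbauer_root_iff[OF assms(1,2)] by blast
        with g_eq_0 L show ?thesis by blast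
      qed
      \<comment> \<open>Negating the angle reverses only the first term of \<open>g\<close>, so both
        terms vanish.\<close>
      from this[OF cos(1)] this[OF cos(2)]
      have "sin \<theta> * poly (pderiv a) x = 0 \<and> sin \<theta> ^ (2 * m) * poly (odd_derivative m b) x = 0"
        unfolding g using cos by (auto simp: eq_neg_iff_add_eq_0)
      moreover have "sin \<theta> \<noteq> 0" using gegenbauer_root_sin[OF assms(1,2), of \<theta>] x cos by simp
      ultimately show ?thesis by simp
    qed
    then show "?C dvd pderiv a \<and> ?C dvd odd_derivative m b"
      unfolding rsquarefree_dvd_iff[OF rsquarefree_gegenbauer[OF assms(1,2)]] by blast
  next
    assume R: "?C dvd pderiv a \<and> ?C dvd odd_derivative m b"
    show "\<forall>i\<in>{1..n}. g (complex_of_real (\<phi> i)) = 0"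
    proof
      fix i assume "i \<in> {1..n}"
      then have "poly ?C (cos (complex_of_real (\<phi> i))) = 0"
        unfolding gegenbauer_root_iff[OF assms(1,2)] config_node_def by blast
      with R show "g (complex_of_real (\<phi> i)) = 0" unfolding g by (auto elim!: dvdE)
    qed
  qed
  finally show ?thesis by (simp add: p_def)
qed

definition even_solutions :: "nat \<Rightarrow> nat \<Rightarrow> nat \<Rightarrow> complex poly set" where
  "even_solutions m n k = {a \<in> even_profiles k. gegenbauer m n dvd pderiv a}"

definition odd_solutions :: "nat \<Rightarrow> nat \<Rightarrow> nat \<Rightarrow> complex poly set" where
  "odd_solutions m n k = {b \<in> odd_profiles m k. gegenbauer m n dvd odd_derivative m b}"

definition solutions :: "nat \<Rightarrow> nat \<Rightarrow> nat \<Rightarrow> complex poly set" where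
  "solutions m n k = {a + b | a b. a \<in> even_solutions m n k \<and> b \<in> odd_solutions m n k}"

lemma odd_derivative_add: "odd_derivative m (p + q) = odd_derivative m p + odd_derivative m q"
  by (rule poly_ext) (simp add: poly_odd_derivative pderiv_add algebra_simps)

lemma odd_derivative_smult: "odd_derivative m (smult c p) = smult c (odd_derivative m p)"
  by (rule poly_ext) (simp add: poly_odd_derivative pderiv_smult algebra_simps)

lemma solutions_subspace: "poly_vs.subspace (solutions m n k)"
  unfolding solutions_def
proof (rule poly_vs.subspace_sums)
  show "poly_vs.subspace (even_solutions m n k)"
    using even_profiles_subspace[of k] unfolding even_solutions_def poly_vs.subspace_def
    by (simp add: pderiv_add pderiv_smult dvd_smult)
  show "poly_vs.subspace (odd_solutions m n k)"
    \<comment> \<open>The instance at 0 says that \<open>odd_derivative m 0 = 0\<close>.\<close>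
    using odd_profiles_subspace[of m k] odd_derivative_smult[of m 0 0]
    unfolding odd_solutions_def poly_vs.subspace_def
    by (simp add: odd_derivative_add odd_derivative_smult dvd_smult)
qed

lemma Q_config_eq_image:
  assumes "m \<ge> 1" "config_angles m n \<phi>"
  shows "Q_config m n \<phi> \<inter> homogeneous2 k = homogenize m k ` solutions m n k"
proof (intro equalityI subsetI)
  fix p assume p: "p \<in> Q_config m n \<phi> \<inter> homogeneous2 k"
  then have "x1_quasi_invariant m p" using Q_config_iff[OF assms(2)] by blast
  with p obtain a b where ab: "a \<in> even_profiles k" "b \<in> odd_profiles m k" "p = homogenize m k (a + b)"
    using homogenize_surj by blast
  with p homogenize_config_iff[OF assms ab(1,2)] have "a + b \<in> solutions m n k"
    by (auto simp: solutions_def even_solutions_def odd_solutions_def)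
  with ab show "p \<in> homogenize m k ` solutions m n k" by blast
next
  fix p assume "p \<in> homogenize m k ` solutions m n k"
  then obtain a b where ab: "a \<in> even_profiles k" "b \<in> odd_profiles m k"
    "gegenbauer m n dvd pderiv a" "gegenbauer m n dvd odd_derivative m b" "p = homogenize m k (a + b)"
    by (auto simp: solutions_def even_solutions_def odd_solutions_def)
  have "p \<in> homogeneous2 k"
    unfolding ab(5) homogenize_add by (intro cpoly2.subspace_add homogeneous2_subspace
        homogenize_even_homogeneous2 homogenize_odd_homogeneous2 ab)
  then show "p \<in> Q_config m n \<phi> \<inter> homogeneous2 k"
    using homogenize_config_iff[OF assms ab(1,2)] ab by blast
qed

lemma inj_on_homogenize: "inj_on (homogenize m k) (solutions m n k)"
proof (rule inj_onI)
  fix y y' assume y: "y \<in> solutions m n k" "y' \<in> solutions m n k" "homogenize m k y = homogenize m k y'"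
  have "y - y' \<in> solutions m n k" using y solutions_subspace poly_vs.subspace_diff by blast
  then obtain a b where ab: "a \<in> even_profiles k" "b \<in> odd_profiles m k" "y - y' = a + b"
    by (auto simp: solutions_def even_solutions_def odd_solutions_def)
  have "homogenize m k (y - y') = 0"
    using homogenize_add[of m k "y - y'" y'] y(3) by simp
  then have "homogenize m k a + homogenize m k b = 0"
    unfolding ab(3) homogenize_add .
  then have sum0: "eval2 (homogenize m k a) x + eval2 (homogenize m k b) x = 0" for x
    by (metis eval2_simps(1,3))
  have "poly a (cos \<theta>) - sin \<theta> ^ (2 * m + 1) * poly b (cos \<theta>) = 0" for \<theta>
    using sum0[of "(- sin \<theta>, cos \<theta>)"]
    unfolding homogenize_even_circle[OF ab(1)] homogenize_odd_circle[OF ab(2)] by simp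
  then have "a = 0" "b = 0" by (rule even_odd_circle_eq_0)+
  with ab show "y = y'" by simp
qed

section \<open>Counting degrees\<close>

text \<open>The coefficient at \<open>degree b + 1\<close> is the leading coefficient of
  \<open>b\<close> times \<open>2m + 1 + degree b\<close>, which is never 0.\<close>

lemma odd_derivative_degree:
  assumes "b \<noteq> 0"
  shows "odd_derivative m b \<noteq> 0" "degree (odd_derivative m b) \<le> Suc (degree b)"
proof -
  define d where "d = degree b"
  have "coeff (odd_derivative m b) (Suc d) = (of_nat (2 * m + 1) + of_nat d) * coeff b d"
  proof -
    have "coeff ([:1, 0, -1:] * pderiv b) (Suc d) = - (of_nat d * coeff b d)"
      by (cases d) (simp_all add: d_def[symmetric] coeff_pderiv coeff_eq_0 del: of_nat_Suc)
    then show ?thesis by (simp add: odd_derivative_def algebra_simps)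
  qed
  moreover have "(of_nat (2 * m + 1) + of_nat d :: complex) \<noteq> 0"
    unfolding of_nat_add[symmetric] of_nat_eq_0_iff by simp
  ultimately show "odd_derivative m b \<noteq> 0"
    using assms by (auto simp: d_def)
  have "coeff (odd_derivative m b) i = 0" if "Suc d < i" for i
  proof -
    have "coeff ([:1, 0, -1:] * pderiv b) i = 0" "coeff ([:0, 1:] * b) i = 0"
      using that by (cases i; cases "i - 1"; simp add: d_def coeff_pderiv coeff_eq_0)+
    then show ?thesis
      unfolding odd_derivative_def coeff_diff coeff_smult by (simp only: mult_zero_right diff_zero)
  qed
  then show "degree (odd_derivative m b) \<le> Suc (degree b)"
    unfolding d_def by (intro degree_le) simp
qed

definition even_degrees :: "nat \<Rightarrow> nat \<Rightarrow> nat set" where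
  "even_degrees n k = {d. even (k + d) \<and> d \<le> k \<and> (d = 0 \<or> n + 1 \<le> d)}"

text \<open>The last two conditions describe the numbers \<open>n + j - 1\<close> with
  \<open>j \<noteq> n\<close>, the degrees of the Wronskians of a polynomial of degree
  \<open>n\<close> with \<open>x^j\<close>.\<close>

definition odd_degrees :: "nat \<Rightarrow> nat \<Rightarrow> nat \<Rightarrow> nat set" where
  "odd_degrees m n k = {d. odd (k + d) \<and> 2 * m + 1 + d \<le> k \<and> n \<le> d + 1 \<and> d \<noteq> 2 * n - 1}"

text \<open>A nonzero derivative divisible by \<open>C\<close> has degree at least \<open>n\<close>.
  Conversely, constants realize 0, and a primitive of \<open>C x^(d-1-n)\<close> realizes
  \<open>d\<close> with the right parity.\<close>

lemma degree_even_solutions: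
  assumes "m \<ge> 1" "config_angles m n \<phi>"
  shows "degree ` (even_solutions m n k - {0}) = even_degrees n k"
proof (intro equalityI subsetI)
  fix d assume "d \<in> degree ` (even_solutions m n k - {0})"
  then obtain a where a: "a \<in> even_profiles k" "gegenbauer m n dvd pderiv a" "a \<noteq> 0" "d = degree a"
    by (auto simp: even_solutions_def)
  then have "coeff a d \<noteq> 0" by simp
  with a(1) have "even (k + d) \<and> d \<le> k" unfolding even_profiles_def by blast
  moreover have "n + 1 \<le> d" if "d \<noteq> 0"
  proof -
    have "pderiv a \<noteq> 0" using that a(4) by (simp add: pderiv_eq_0_iff)
    then have "n \<le> degree (pderiv a)"
      using dvd_imp_degree_le[OF a(2)] degree_gegenbauer_config[OF assms] by simp
    then show ?thesis using that a(4) by (simp add: degree_pderiv)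
  qed
  ultimately show "d \<in> even_degrees n k" unfolding even_degrees_def by blast
next
  fix d assume d: "d \<in> even_degrees n k"
  let ?C = "gegenbauer m n"
  have "?C \<noteq> 0" using rsquarefree_gegenbauer[OF assms] by (simp add: rsquarefree_def)
  consider "d = 0" | "n + 1 \<le> d" using d by (auto simp: even_degrees_def)
  then show "d \<in> degree ` (even_solutions m n k - {0})"
  proof cases
    case 1
    have "1 \<in> even_solutions m n k"
      using d 1 by (auto simp: even_solutions_def even_profiles_def even_degrees_def pderiv_1 split: if_splits)
    with 1 show ?thesis by (intro image_eqI[of _ _ 1]) auto
  next
    case 2
    define q where "q = ?C * monom 1 (d - 1 - n)"
    define a where "a = poly_integral q"
    have "q \<noteq> 0" using \<open>?C \<noteq> 0\<close> by (simp add: q_def)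
    have "degree q = d - 1"
      using \<open>?C \<noteq> 0\<close> 2 by (simp add: q_def degree_mult_eq degree_monom_eq degree_gegenbauer_config[OF assms])
    then have deg: "degree a = d"
      using degree_poly_integral[OF \<open>q \<noteq> 0\<close>] 2 by (simp add: a_def)
    have "has_parity (n + (d - 1 - n)) q"
      unfolding q_def by (intro has_parity_mult has_parity_gegenbauer has_parity_monom) simp
    then have "has_parity d a"
      using has_parity_poly_integral[of "d - 1" q] 2 by (simp add: a_def)
    have "a \<in> even_profiles k"
      unfolding even_profiles_def
    proof (intro CollectI allI impI)
      fix j assume j: "coeff a j \<noteq> 0"
      then have "even (d + j)" "j \<le> d"
        using \<open>has_parity d a\<close> le_degree[OF j] deg unfolding has_parity_def by blast+
      then show "even (k + j) \<and> j \<le> k" using d by (auto simp: even_degrees_def)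
    qed
    moreover have "?C dvd pderiv a" by (simp add: a_def q_def)
    moreover have "a \<noteq> 0" using deg 2 by auto
    ultimately show ?thesis using deg by (auto simp: even_solutions_def image_iff)
  qed
qed

text \<open>Divisibility gives the lower bound, and \<open>residue_free_degree\<close> excludes
  \<open>2 * n - 1\<close>. The Wronskian with \<open>x^j\<close> for \<open>j = d + 1 - n\<close>
  realizes every other degree.\<close>

lemma degree_odd_solutions:
  assumes "m \<ge> 1" "n \<ge> 1" "config_angles m n \<phi>"
  shows "degree ` (odd_solutions m n k - {0}) = odd_degrees m n k"
proof (intro equalityI subsetI)
  fix d assume "d \<in> degree ` (odd_solutions m n k - {0})"
  then obtain b where b: "b \<in> odd_profiles m k" "gegenbauer m n dvd odd_derivative m b" "b \<noteq> 0" "d = degree b"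
    by (auto simp: odd_solutions_def)
  then have "coeff b d \<noteq> 0" by simp
  with b(1) have "odd (k + d) \<and> 2 * m + 1 + d \<le> k" unfolding odd_profiles_def by blast
  moreover have "n \<le> d + 1"
    using dvd_imp_degree_le[OF b(2)] odd_derivative_degree[OF b(3), of m] b(4)
      degree_gegenbauer_config[OF assms(1,3)] by simp
  moreover have "degree b \<noteq> 2 * degree (gegenbauer m n) - 1"
    using b(2) assms(2) unfolding gegenbauer_dvd_odd_derivative_iff[OF assms(1,3)]
    by (intro residue_free_degree[OF rsquarefree_gegenbauer[OF assms(1,3)]])
       (simp_all only: degree_gegenbauer_config[OF assms(1,3)])
  then have "d \<noteq> 2 * n - 1" by (simp add: b(4) degree_gegenbauer_config[OF assms(1,3)])
  ultimately show "d \<in> odd_degrees m n k" unfolding odd_degrees_def by blast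
next
  fix d assume d: "d \<in> odd_degrees m n k"
  let ?C = "gegenbauer m n"
  define j where "j = d + 1 - n"
  have j: "d = n + j - 1" "j \<noteq> n" "n \<le> d + 1" using d assms(2) by (auto simp: odd_degrees_def j_def)
  define q where "q = monom (1 :: complex) j"
  define b where "b = pderiv ?C * q - ?C * pderiv q"
  have "?C \<noteq> 0" using rsquarefree_gegenbauer[OF assms(1,3)] by (simp add: rsquarefree_def)
  have q: "q \<noteq> 0" "degree q = j" by (simp_all add: q_def degree_monom_eq)
  have deg: "degree b = d"
    using degree_wronskian[OF \<open>?C \<noteq> 0\<close> q(1)] q(2) j
    by (simp add: b_def degree_gegenbauer_config[OF assms(1,3)])
  have "b \<noteq> 0"
  proof -
    have "coeff b (n + j - 1) \<noteq> 0"
      using coeff_wronskian[of ?C n q j] \<open>?C \<noteq> 0\<close> q j assms(2) leading_coeff_neq_0[of ?C]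
      by (simp add: b_def degree_gegenbauer_config[OF assms(1,3)] q_def)
    then show ?thesis by auto
  qed
  have "has_parity (Suc n + j) b"
    unfolding b_def
  proof (rule has_parity_diff)
    have "has_parity j q" by (simp add: q_def has_parity_monom)
    then show "has_parity (Suc n + j) (pderiv ?C * q)"
      by (intro has_parity_mult has_parity_pderiv has_parity_gegenbauer)
    have "has_parity (n + Suc j) (?C * pderiv q)"
      using \<open>has_parity j q\<close> by (intro has_parity_mult has_parity_pderiv has_parity_gegenbauer)
    then show "has_parity (Suc n + j) (?C * pderiv q)" by simp
  qed
  have "b \<in> odd_profiles m k"
    unfolding odd_profiles_def
  proof (intro CollectI allI impI)
    fix i assume i: "coeff b i \<noteq> 0"
    then have "even (Suc n + j + i)" and "i \<le> d"
      using \<open>has_parity (Suc n + j) b\<close> le_degree[OF i] deg unfolding has_parity_def by blast+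
    moreover have "Suc n + j + i = d + i + 2" using j assms(2) by simp
    ultimately have "even (d + i + 2)" by (simp only:)
    with \<open>i \<le> d\<close> show "odd (k + i) \<and> 2 * m + 1 + i \<le> k" using d by (auto simp: odd_degrees_def)
  qed
  \<comment> \<open>At a root of \<open>C\<close> the terms \<open>C' q'\<close> cancel in the
    derivative of the Wronskian, leaving \<open>b = C' q\<close> and
    \<open>b' = C'' q\<close>.\<close>
  moreover have "?C dvd odd_derivative m b"
    unfolding gegenbauer_dvd_odd_derivative_iff[OF assms(1,3)]
    by (auto simp: b_def pderiv_diff pderiv_mult)
  ultimately show "d \<in> degree ` (odd_solutions m n k - {0})"
    using deg \<open>b \<noteq> 0\<close> by (auto simp: odd_solutions_def image_iff)
qed

text \<open>The two profiles have exponents of opposite parity, so their leading terms cannot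
  cancel.\<close>

lemma degree_add_profiles:
  assumes a: "a \<in> even_profiles k" and b: "b \<in> odd_profiles m k" and "a + b \<noteq> 0"
  shows "(a \<noteq> 0 \<and> degree (a + b) = degree a) \<or> (b \<noteq> 0 \<and> degree (a + b) = degree b)"
proof (cases "degree a = degree b")
  case True
  have "a = 0 \<or> b = 0"
  proof (rule ccontr)
    assume "\<not> (a = 0 \<or> b = 0)"
    then have "coeff a (degree a) \<noteq> 0" "coeff b (degree a) \<noteq> 0"
      using leading_coeff_neq_0[of a] leading_coeff_neq_0[of b] unfolding True by auto
    with a b show False unfolding even_profiles_def odd_profiles_def by blast
  qed
  with assms(3) show ?thesis by auto
next
  case False
  then show ?thesis
  proof (cases "degree a < degree b")
    case True
    then show ?thesis by (auto simp: degree_add_eq_right)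
  next
    case False
    with \<open>degree a \<noteq> degree b\<close> have "degree b < degree a" by simp
    then show ?thesis by (auto simp: degree_add_eq_left)
  qed
qed

lemma degree_solutions:
  assumes "m \<ge> 1" "n \<ge> 1" "config_angles m n \<phi>"
  shows "degree ` (solutions m n k - {0}) = even_degrees n k \<union> odd_degrees m n k"
  unfolding degree_even_solutions[OF assms(1,3), symmetric] degree_odd_solutions[OF assms, symmetric]
proof (intro equalityI subsetI)
  fix d assume "d \<in> degree ` (solutions m n k - {0})"
  then obtain a b where ab: "a \<in> even_solutions m n k" "b \<in> odd_solutions m n k" "a + b \<noteq> 0" "d = degree (a + b)"
    by (auto simp: solutions_def)
  then show "d \<in> degree ` (even_solutions m n k - {0}) \<union> degree ` (odd_solutions m n k - {0})"
    using degree_add_profiles[of a k b m] unfolding even_solutions_def odd_solutions_def by auto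
next
  fix d assume d: "d \<in> degree ` (even_solutions m n k - {0}) \<union> degree ` (odd_solutions m n k - {0})"
  have "0 \<in> even_solutions m n k"
    by (simp add: even_solutions_def even_profiles_def)
  moreover have "0 \<in> odd_solutions m n k"
    using odd_derivative_smult[of m 0 0] by (simp add: odd_solutions_def odd_profiles_def)
  ultimately have "even_solutions m n k \<subseteq> solutions m n k" "odd_solutions m n k \<subseteq> solutions m n k"
    unfolding solutions_def by (force simp del: even_add)+
  with d show "d \<in> degree ` (solutions m n k - {0})" by blast
qed

section \<open>Cardinalities of the degree sets\<close>

lemma card_arith_progression: "card {d :: nat. even (k + d) \<and> s \<le> d \<and> d \<le> k} = (if k < s then 0 else (k - s) div 2 + 1)"
proof (cases "k < s")
  case True
  then have "{d. even (k + d) \<and> s \<le> d \<and> d \<le> k} = {}" by auto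
  with True show ?thesis by simp
next
  case False
  have "bij_betw (\<lambda>i. k - 2 * i) {..(k - s) div 2} {d. even (k + d) \<and> s \<le> d \<and> d \<le> k}"
  proof (rule bij_betw_byWitness[where f' = "\<lambda>d. (k - d) div 2"])
    show "(\<lambda>i. k - 2 * i) ` {..(k - s) div 2} \<subseteq> {d. even (k + d) \<and> s \<le> d \<and> d \<le> k}"
      using False by auto
    show "(\<lambda>d. (k - d) div 2) ` {d. even (k + d) \<and> s \<le> d \<and> d \<le> k} \<subseteq> {..(k - s) div 2}"
      by (auto intro!: div_le_mono)
    show "\<forall>d\<in>{d. even (k + d) \<and> s \<le> d \<and> d \<le> k}. k - 2 * ((k - d) div 2) = d" by auto
  qed (use False in auto)
  then show ?thesis using False bij_betw_same_card by fastforce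
qed

text \<open>By \<open>card_arith_progression\<close>, the number of \<open>d\<close> with the parity
  of \<open>k\<close> between \<open>s\<close> and \<open>k\<close>.\<close>

definition steps_from :: "nat \<Rightarrow> nat \<Rightarrow> nat" where
  "steps_from s k = (if k < s then 0 else (k - s) div 2 + 1)"

text \<open>With \<open>s = 0\<close> it counts the degree 0 of constant profiles, with
  \<open>s = 2 * m + 2 * n\<close> the excluded degree \<open>2 * n - 1\<close>.\<close>

definition even_from :: "nat \<Rightarrow> nat \<Rightarrow> nat" where
  "even_from s k = (if even k \<and> s \<le> k then 1 else 0)"

lemma card_even_degrees: "card (even_degrees n k) = steps_from (n + 1) k + even_from 0 k"
proof -
  have "even_degrees n k = {d. even (k + d) \<and> n + 1 \<le> d \<and> d \<le> k} \<union> (if even k then {0} else {})"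
    by (auto simp: even_degrees_def)
  moreover have "finite {d. even (k + d) \<and> n + 1 \<le> d \<and> d \<le> k}" by (rule finite_subset[of _ "{..k}"]) auto
  ultimately have "card (even_degrees n k) = card {d. even (k + d) \<and> n + 1 \<le> d \<and> d \<le> k} + card (if even k then {0::nat} else {})"
    by (simp add: card_Un_disjoint)
  then show ?thesis unfolding card_arith_progression steps_from_def even_from_def by simp
qed

text \<open>Adding \<open>2 * m + 1\<close> moves the degrees to those of the parity of
  \<open>k\<close> between \<open>2 * m + n\<close> and \<open>k\<close>, and
  \<open>2 * n - 1\<close> to \<open>2 * m + 2 * n\<close>. The exclusion is added on the left to
  avoid subtraction of natural numbers.\<close>

lemma card_odd_degrees:
  assumes "n \<ge> 1"
  shows "card (odd_degrees m n k) + even_from (2 * m + 2 * n) k = steps_from (2 * m + n) k"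
proof -
  define S where "S = {d. odd (k + d) \<and> 2 * m + 1 + d \<le> k \<and> n \<le> d + 1}"
  have "finite S" unfolding S_def by (rule finite_subset[of _ "{..k}"]) auto
  have "bij_betw (\<lambda>d. 2 * m + 1 + d) S {d. even (k + d) \<and> 2 * m + n \<le> d \<and> d \<le> k}"
    using assms by (intro bij_betw_byWitness[where f' = "\<lambda>d. d - (2 * m + 1)"]) (auto simp: S_def)
  then have "card S = steps_from (2 * m + n) k"
    unfolding steps_from_def card_arith_progression[symmetric] by (rule bij_betw_same_card)
  moreover have "odd_degrees m n k = S - {2 * n - 1}" by (auto simp: odd_degrees_def S_def)
  moreover have "2 * n - 1 \<in> S \<longleftrightarrow> even k \<and> 2 * m + 2 * n \<le> k"
    using assms by (auto simp: S_def)
  moreover have "card S > 0" if "2 * n - 1 \<in> S" using that \<open>finite S\<close> by (auto simp: card_gt_0_iff)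
  ultimately show ?thesis using \<open>finite S\<close> by (auto simp: even_from_def card_Diff_singleton_if)
qed

lemma dim_Q_config:
  assumes "m \<ge> 1" "n \<ge> 1" "config_angles m n \<phi>"
  shows "cpoly2.dim (Q_config m n \<phi> \<inter> homogeneous2 k) + even_from (2 * m + 2 * n) k
    = steps_from (n + 1) k + steps_from (2 * m + n) k + even_from 0 k"
proof -
  have fin: "finite (even_degrees n k)" "finite (odd_degrees m n k)"
    by (rule finite_subset[of _ "{..k}"]; auto simp: even_degrees_def odd_degrees_def)+
  have "even_degrees n k \<inter> odd_degrees m n k = {}"
    unfolding even_degrees_def odd_degrees_def by blast
  then have "cpoly2.dim (Q_config m n \<phi> \<inter> homogeneous2 k) = card (even_degrees n k) + card (odd_degrees m n k)"
    unfolding Q_config_eq_image[OF assms(1,3)]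
    by (subst dim_image_eq_card_degrees[OF homogenize_linear inj_on_homogenize solutions_subspace])
       (simp_all add: degree_solutions[OF assms] fin card_Un_disjoint)
  then show ?thesis using card_even_degrees[of n k] card_odd_degrees[OF assms(2), of m k] by simp
qed

section \<open>Generating functions of the counts\<close>

lemma even_from_rec:
  "even_from (2 * s) k = (if k < 2 then 0 else even_from (2 * s) (k - 2)) + (if k = 2 * s then 1 else 0)"
  unfolding even_from_def by (auto; presburger)

lemma steps_from_rec:
  "steps_from s k = (if k < 2 then 0 else steps_from s (k - 2)) + (if s \<le> k then 1 else 0)"
  unfolding steps_from_def by (auto; presburger)

lemma fps_X_power_mult_Abs_nth:
  "fps_nth (fps_X ^ s * Abs_fps f :: 'a::comm_ring_1 fps) k = (if k < s then 0 else f (k - s))"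
  by (simp add: fps_X_power_mult_nth)

lemma even_from_fps:
  "(1 - fps_X ^ 2) * Abs_fps (\<lambda>k. of_nat (even_from (2 * s) k)) = (fps_X ^ (2 * s) :: rat fps)"
proof (rule fps_ext)
  fix k
  show "fps_nth ((1 - fps_X ^ 2) * Abs_fps (\<lambda>k. of_nat (even_from (2 * s) k))) k
      = fps_nth (fps_X ^ (2 * s) :: rat fps) k"
    unfolding left_diff_distrib mult_1_left fps_sub_nth fps_X_power_mult_Abs_nth fps_X_power_nth fps_nth_Abs_fps
    by (subst even_from_rec) simp
qed

text \<open>One factor \<open>1 - X^2\<close> takes differences at distance 2 and leaves the
  indicator \<open>U\<close> of \<open>s \<le> k\<close>; the second leaves the two terms at
  \<open>s\<close> and \<open>s + 1\<close>.\<close>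

lemma steps_from_fps:
  "(1 - fps_X ^ 2)\<^sup>2 * Abs_fps (\<lambda>k. of_nat (steps_from s k)) = (fps_X ^ s + fps_X ^ (s + 1) :: rat fps)"
proof -
  define U :: "rat fps" where "U = Abs_fps (\<lambda>k. if s \<le> k then 1 else 0)"
  have "(1 - fps_X ^ 2) * Abs_fps (\<lambda>k. of_nat (steps_from s k)) = U"
  proof (rule fps_ext)
    fix k
    show "fps_nth ((1 - fps_X ^ 2) * Abs_fps (\<lambda>k. of_nat (steps_from s k))) k = fps_nth U k"
      unfolding U_def left_diff_distrib mult_1_left fps_sub_nth fps_X_power_mult_Abs_nth fps_nth_Abs_fps
      by (subst steps_from_rec) simp
  qed
  moreover have "(1 - fps_X ^ 2) * U = fps_X ^ s + fps_X ^ (s + 1)"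
  proof (rule fps_ext)
    fix k
    show "fps_nth ((1 - fps_X ^ 2) * U) k = fps_nth (fps_X ^ s + fps_X ^ (s + 1)) k"
      unfolding U_def left_diff_distrib mult_1_left fps_sub_nth fps_add_nth fps_X_power_mult_Abs_nth
        fps_X_power_nth fps_nth_Abs_fps by auto
  qed
  ultimately show ?thesis by (simp add: power2_eq_square mult.assoc)
qed

theorem theorem6p31:
  fixes m n :: nat and \<phi> :: "nat \<Rightarrow> real"
  assumes "m \<ge> 1" and "n \<ge> 1"
    and "config_angles m n \<phi>"
  shows "hilbert_series (Q_config m n \<phi>) =
    (1 - fps_X ^ 2 + fps_X ^ (n + 1) + fps_X ^ (n + 2) + fps_X ^ (2 * m + n)
       + fps_X ^ (2 * m + n + 1) - fps_X ^ (2 * m + 2 * n) + fps_X ^ (2 * m + 2 * n + 2))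
      / (fps_X ^ 2 - 1) ^ 2"
proof -
  define S where "S s = Abs_fps (\<lambda>k. of_nat (steps_from s k) :: rat)" for s
  define E where "E s = Abs_fps (\<lambda>k. of_nat (even_from (2 * s) k) :: rat)" for s
  define W where "W = (1 - fps_X ^ 2 :: rat fps)"
  have E: "W * E s = fps_X ^ (2 * s)" for s unfolding W_def E_def by (rule even_from_fps)
  have S: "W\<^sup>2 * S s = fps_X ^ s + fps_X ^ (s + 1)" for s unfolding W_def S_def by (rule steps_from_fps)
  have "hilbert_series (Q_config m n \<phi>) + E (m + n) = S (n + 1) + S (2 * m + n) + E 0"
  proof (rule fps_ext)
    fix k
    have "of_nat (cpoly2.dim (Q_config m n \<phi> \<inter> homogeneous2 k)) + of_nat (even_from (2 * (m + n)) k)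
      = (of_nat (steps_from (n + 1) k) + of_nat (steps_from (2 * m + n) k) + of_nat (even_from (2 * 0) k) :: rat)"
      using arg_cong[OF dim_Q_config[OF assms, of k], of "of_nat :: nat \<Rightarrow> rat"] by (simp add: distrib_left)
    then show "fps_nth (hilbert_series (Q_config m n \<phi>) + E (m + n)) k = fps_nth (S (n + 1) + S (2 * m + n) + E 0) k"
      by (simp add: hilbert_series_def E_def S_def)
  qed
  then have H: "hilbert_series (Q_config m n \<phi>) = S (n + 1) + S (2 * m + n) + E 0 - E (m + n)"
    by (simp add: eq_diff_eq)
  \<comment> \<open>The series \<open>E\<close> absorb only one factor \<open>W\<close>; the other
    one remains and produces the differences in the numerator.\<close>
  have "hilbert_series (Q_config m n \<phi>) * W\<^sup>2
      = W\<^sup>2 * S (n + 1) + W\<^sup>2 * S (2 * m + n) + W * (W * E 0) - W * (W * E (m + n))"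
    unfolding H by (simp add: algebra_simps power2_eq_square)
  also have "\<dots> = 1 - fps_X ^ 2 + fps_X ^ (n + 1) + fps_X ^ (n + 2) + fps_X ^ (2 * m + n)
       + fps_X ^ (2 * m + n + 1) - fps_X ^ (2 * m + 2 * n) + fps_X ^ (2 * m + 2 * n + 2)"
  proof -
    have "(x ^ (n + 1) + x ^ (n + 1 + 1)) + (x ^ (2 * m + n) + x ^ (2 * m + n + 1))
        + (1 - x ^ 2) * x ^ (2 * 0) - (1 - x ^ 2) * x ^ (2 * (m + n))
      = 1 - x ^ 2 + x ^ (n + 1) + x ^ (n + 2) + x ^ (2 * m + n)
        + x ^ (2 * m + n + 1) - x ^ (2 * m + 2 * n) + x ^ (2 * m + 2 * n + 2)" for x :: "rat fps"
      by (simp add: algebra_simps power_add power2_eq_square)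
    then show ?thesis unfolding S E unfolding W_def .
  qed
  finally have *: "hilbert_series (Q_config m n \<phi>) * W\<^sup>2 = \<dots>" .
  \<comment> \<open>The constant coefficient shows that \<open>W\<close> is nonzero, so division by
    its square cancels.\<close>
  have "fps_nth W 0 = 1" by (simp add: W_def)
  then have "W \<noteq> 0" by auto
  moreover have "(fps_X ^ 2 - 1)\<^sup>2 = W\<^sup>2" by (simp add: W_def power2_commute)
  ultimately show ?thesis unfolding *[symmetric] by simp
qed

end
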